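(* Let $k\ge 0$, $h\ge 1$, $m$ and $r$ be integers with $m-k>1$, where $2\le r\le k+2$ if $h=1$ and $1\le r\le k+1$ if $h>1$. Write $r'=\min\{r,k+1\}$, and let $2^t$ be the largest power of $2$ not exceeding $$\left[\frac{(m-k)!}{2}\right]^{2^{\min\{r+h-3,k\}}}.$$ Then there exist $2^t$ distinct cosets of $\mathcal{A}(k,r',m,h)$, each containing a word in $\mathcal{R}(k,m,h)$ with effective degree at most $r$. Moreover, if $\mathcal{C}\subseteq\mathbb{Z}_{2^h}^{2^m}$ is the union of any $2^t$ such distinct cosets, then: (i) the polyphase version of every word in $\mathcal{C}$ has PMEPR at most $2^{k+1}$; (ii) one can encode $s+t$ bits, i.e. $|\mathcal{C}|=2^{s+t}$, where $s=\log_2|\mathcal{A}(k,r',m,h)|$; (iii) $\mathcal{C}$ is a subcode of $\mathrm{ERM}(r,m,h)$, and its minimum Lee distance and minimum squared Euclidean distance are at least $2^{m-r}$ and $2^{m-r+2}\sin^2\left(\frac{\pi}{2^h}\right)$, respectively; (iv) if $r=r'$, both bounds in (iii) hold with equality.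
   Context: A generalized Boolean function is a map $f:\{0,1\}^m\to\mathbb{Z}_{2^h}$ in variables $x_0,\dots,x_{m-1}$; it is uniquely a polynomial $\sum_{i\in\{0,1\}^m}c_i\prod_\alpha x_\alpha^{i_\alpha}$, $c_i\in\mathbb{Z}_{2^h}$ (algebraic normal form), and $\deg$ denotes the algebraic degree of this form, with the convention $\deg(0)=-\infty$. The word associated with $f$ is $\psi(f)=(f_0,\dots,f_{2^m-1})\in\mathbb{Z}_{2^h}^{2^m}$, where $f_i=f(i_0,\dots,i_{m-1})$ and $i=\sum_\alpha i_\alpha2^\alpha$, $i_\alpha\in\{0,1\}$. The effective degree of $f$ is $\max_{0\le i<h}[\deg(f\bmod 2^{i+1})-i]$, where $f\bmod 2^{i+1}$ is obtained by reducing the coefficients modulo $2^{i+1}$; the effective degree of a word $\psi(f)$ means that of $f$. $\mathcal{F}(\rho,m,h)$ is the set of all generalized Boolean functions $\{0,1\}^m\to\mathbb{Z}_{2^h}$ of effective degree at most $\rho$, and $\mathrm{ERM}(r,m,h)=\{\psi(f)\mid f\in\mathcal{F}(r,m,h)\}$ (the effective-degree Reed--Muller code). For $0\le k<m$, $0\le r\le k+1$, $h\ge1$, $\mathcal{A}(k,r,m,h)$ is the set of words associated with the functions $$\sum_{i=0}^{m-k-1}x_i\,g_i(x_{m-k},\dots,x_{m-1})+g(x_{m-k},\dots,x_{m-1}),$$ where $g_0,\dots,g_{m-k-1}\in\mathcal{F}(r-1,k,h)$ and $g\in\mathcal{F}(r,k,h)$. It is a linear code (submodule) over $\mathbb{Z}_{2^h}$;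 a coset of it is a set $\{\boldsymbol{a}+\boldsymbol{c}\mid\boldsymbol{c}\in\mathcal{A}(k,r,m,h)\}$ with $\boldsymbol{a}\in\mathbb{Z}_{2^h}^{2^m}$. $\mathcal{R}(k,m,h)$ is the set of words associated with the functions $$2^{h-1}\sum_{\boldsymbol{d}\in\{0,1\}^k}\ \sum_{i=0}^{m-k-2}x_{\pi_{\boldsymbol{d}}(i)}x_{\pi_{\boldsymbol{d}}(i+1)}\prod_{j=0}^{k-1}x_{m-k+j}^{d_j}(1-x_{m-k+j})^{1-d_j},$$ where $\boldsymbol{d}=(d_0,\dots,d_{k-1})$ and $\pi_{\boldsymbol{d}}$ ($\boldsymbol{d}\in\{0,1\}^k$) are arbitrary $2^k$ permutations of $\{0,1,\dots,m-k-1\}$ (with $0^0=1$). Let $\xi=e^{2\pi\sqrt{-1}/2^h}$. The polyphase version of $\boldsymbol{c}=(c_0,\dots,c_{n-1})\in\mathbb{Z}_{2^h}^n$ is $\boldsymbol{C}=(\xi^{c_0},\dots,\xi^{c_{n-1}})$. Its PMEPR is $\frac1n\sup_{0\le\theta<1}\left|\sum_{i=0}^{n-1}C_ie^{2\pi\sqrt{-1}(i+\zeta)\theta}\right|^2$, with $\zeta$ a fixed positive constant. For $\boldsymbol{a}\in\mathbb{Z}_{2^h}^n$ with entries represented in $\{0,\dots,2^h-1\}$, the Lee weight is $\mathrm{wt}_L(\boldsymbol{a})=\sum_i\min\{a_i,2^h-a_i\}$ and the squared Euclidean weight is $\mathrm{wt}_E^2(\boldsymbol{a})=\sum_i|\xi^{a_i}-1|^2$.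 The Lee and squared Euclidean distances between $\boldsymbol{a}$ and $\boldsymbol{b}$ are $\mathrm{wt}_L(\boldsymbol{a}-\boldsymbol{b})$ and $\mathrm{wt}_E^2(\boldsymbol{a}-\boldsymbol{b})$; the minimum distances of a code are taken over all pairs of distinct codewords. *)

theory Defs
  imports
    Complex_Main
    "HOL-Library.Extended_Real"
    "HOL-Library.Word"
    "HOL-Combinatorics.Permutations"
    "Jordan_Normal_Form.Matrix"
begin

section \<open>Generalized Boolean functions\<close>

text \<open>The ring of integers modulo \<open>2^h\<close> is the type \<open>'h word\<close> with \<open>h = LENGTH('h)\<close>; since
  \<open>'h\<close> ranges over the class \<open>len\<close>, this covers exactly all \<open>h \<ge> 1\<close>.  A point
  \<open>(x_0, \<dots>, x_{m-1})\<close> is a list of length \<open>m\<close> with entries in \<open>{0,1}\<close>.  A generalized Boolean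
  function in \<open>m\<close> variables is a function \<open>nat list \<Rightarrow> 'h word\<close> of which only the values on
  \<open>cube m\<close> matter: all notions below ignore the other values.\<close>

definition cube :: "nat \<Rightarrow> nat list set" where
  "cube m = {x. set x \<subseteq> {0, 1} \<and> length x = m}"

definition anf_poly :: "nat \<Rightarrow> (nat list \<Rightarrow> 'a::comm_ring_1) \<Rightarrow> nat list \<Rightarrow> 'a" where
  "anf_poly m c x = (\<Sum>i\<in>cube m. c i * (\<Prod>\<alpha><m. of_nat (x ! \<alpha>) ^ (i ! \<alpha>)))"

definition is_anf :: "nat \<Rightarrow> (nat list \<Rightarrow> 'a::comm_ring_1) \<Rightarrow> (nat list \<Rightarrow> 'a) \<Rightarrow> bool" where
  "is_anf m f c \<longleftrightarrow> (\<forall>i. i \<notin> cube m \<longrightarrow> c i = 0) \<and> (\<forall>x\<in>cube m. f x = anf_poly m c x)"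

definition anf :: "nat \<Rightarrow> (nat list \<Rightarrow> 'a::comm_ring_1) \<Rightarrow> nat list \<Rightarrow> 'a" where
  "anf m f = (THE c. is_anf m f c)"

lemma cube_0: "cube 0 = {[]}"
  by (auto simp: cube_def)

lemma cube_Suc: "cube (Suc m) = (#) 0 ` cube m \<union> (#) 1 ` cube m"
  by (auto simp: cube_def length_Suc_conv image_iff)

lemma finite_cube: "finite (cube m)"
  unfolding cube_def by (rule finite_lists_length_eq) simp

lemma anf_poly_0: "anf_poly 0 c x = c []"
  by (simp add: anf_poly_def cube_0)

lemma anf_poly_Cons:
  "anf_poly (Suc m) c (a # x) =
     anf_poly m (\<lambda>i. c (0 # i)) x + of_nat a * anf_poly m (\<lambda>i. c (1 # i)) x"
proof -
  have "anf_poly (Suc m) c (a # x) =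
      (\<Sum>i\<in>(#) 0 ` cube m. c i * (\<Prod>\<alpha><Suc m. of_nat ((a # x) ! \<alpha>) ^ (i ! \<alpha>))) +
      (\<Sum>i\<in>(#) 1 ` cube m. c i * (\<Prod>\<alpha><Suc m. of_nat ((a # x) ! \<alpha>) ^ (i ! \<alpha>)))"
    unfolding anf_poly_def cube_Suc by (rule sum.union_disjoint) (auto simp: finite_cube)
  then show ?thesis
    unfolding anf_poly_def sum_distrib_left
    by (simp add: sum.reindex prod.lessThan_Suc_shift mult_ac del: prod.lessThan_Suc)
qed

lemma ex1_anf: "\<exists>!c. is_anf m f c"
proof (induction m arbitrary: f)
  case 0
  show ?case
  proof (rule ex1I)
    show "is_anf 0 f (\<lambda>i. if i = [] then f [] else 0)"
      by (auto simp: is_anf_def cube_0 anf_poly_0)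
  qed (auto simp: is_anf_def cube_0 anf_poly_0 fun_eq_iff)
next
  case (Suc m)
  let ?f0 = "\<lambda>x. f (0 # x)"
  let ?f1 = "\<lambda>x. f (1 # x) - f (0 # x)"
  obtain c0 where c0: "is_anf m ?f0 c0" "\<And>c. is_anf m ?f0 c \<Longrightarrow> c = c0"
    using Suc[of ?f0] by blast
  obtain c1 where c1: "is_anf m ?f1 c1" "\<And>c. is_anf m ?f1 c \<Longrightarrow> c = c1"
    using Suc[of ?f1] by blast
  let ?c = "\<lambda>i. case i of [] \<Rightarrow> 0 | a # j \<Rightarrow> if a = 0 then c0 j else if a = 1 then c1 j else 0"
  show ?case
  proof (rule ex1I)
    show "is_anf (Suc m) f ?c"
      using c0(1) c1(1)
      by (auto simp: is_anf_def cube_Suc anf_poly_Cons image_iff diff_eq_eq add.commute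
               split: list.splits)
  next
    fix c assume c: "is_anf (Suc m) f c"
    have e0: "(\<lambda>i. c (0 # i)) = c0"
      by (rule c0(2)) (use c in \<open>auto simp: is_anf_def cube_Suc anf_poly_Cons image_iff\<close>)
    have e1: "(\<lambda>i. c (1 # i)) = c1"
      by (rule c1(2)) (use c in \<open>auto simp: is_anf_def cube_Suc anf_poly_Cons image_iff\<close>)
    have z: "c i = 0" if "i \<notin> cube (Suc m)" for i
      using c that by (simp add: is_anf_def)
    show "c = ?c"
    proof
      fix i
      show "c i = ?c i"
      proof (cases i)
        case Nil
        then show ?thesis using z[of i] by (simp add: cube_def)
      next
        case (Cons a j)
        then show ?thesis
          using z[of i] fun_cong[OF e0, of j] fun_cong[OF e1, of j] by (auto simp: cube_def)
      qed
    qed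
  qed
qed

text \<open>Degree of the polynomial with coefficients \<open>c\<close>; the supremum of the empty set is
  \<open>-\<infinity>\<close>, the degree of the zero polynomial.\<close>

definition coeff_degree :: "nat \<Rightarrow> (nat list \<Rightarrow> 'a::zero) \<Rightarrow> ereal" where
  "coeff_degree m c = (SUP i\<in>{i\<in>cube m. c i \<noteq> 0}. ereal (real (sum_list i)))"

definition effective_degree :: "nat \<Rightarrow> (nat list \<Rightarrow> 'h::len word) \<Rightarrow> ereal" where
  "effective_degree m f =
     (MAX i\<in>{..<LENGTH('h)}.
        coeff_degree m (\<lambda>j. uint (anf m f j) mod 2 ^ (i + 1)) - ereal (real i))"

text \<open>The bound is an integer because \<open>code_A k 0 m\<close> refers to effective degree at most \<open>-1\<close>.\<close>

definition GBF :: "int \<Rightarrow> nat \<Rightarrow> (nat list \<Rightarrow> 'h::len word) set" where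
  "GBF \<rho> m = {f. effective_degree m f \<le> ereal (real_of_int \<rho>)}"

section \<open>Words and codes\<close>

definition bits_of :: "nat \<Rightarrow> nat \<Rightarrow> nat list" where
  "bits_of m i = map (\<lambda>\<alpha>. i div 2 ^ \<alpha> mod 2) [0..<m]"

definition psi :: "nat \<Rightarrow> (nat list \<Rightarrow> 'a) \<Rightarrow> 'a vec" where
  "psi m f = vec (2 ^ m) (\<lambda>i. f (bits_of m i))"

definition word_effective_degree :: "nat \<Rightarrow> 'h::len word vec \<Rightarrow> ereal" where
  "word_effective_degree m w = effective_degree m (\<lambda>x. w $ (\<Sum>\<alpha><m. x ! \<alpha> * 2 ^ \<alpha>))"

definition ERM :: "int \<Rightarrow> nat \<Rightarrow> 'h::len word vec set" where
  "ERM r m = psi m ` GBF r m"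

definition code_A :: "nat \<Rightarrow> nat \<Rightarrow> nat \<Rightarrow> 'h::len word vec set" where
  "code_A k r m =
     {psi m (\<lambda>x. (\<Sum>i<m-k. of_nat (x ! i) * G i (drop (m-k) x)) + g (drop (m-k) x)) | G g.
        (\<forall>i<m-k. G i \<in> GBF (int r - 1) k) \<and> g \<in> GBF (int r) k}"

definition cosets_of :: "nat \<Rightarrow> 'a::plus vec set \<Rightarrow> 'a vec set set" where
  "cosets_of n A = {{a + c | c. c \<in> A} | a. a \<in> carrier_vec n}"

definition words_R :: "nat \<Rightarrow> nat \<Rightarrow> 'h::len word vec set" where
  "words_R k m =
     {psi m (\<lambda>x. 2 ^ (LENGTH('h) - 1) *
         (\<Sum>d\<in>cube k. (\<Sum>i<m-k-1. of_nat (x ! (\<pi> d i)) * of_nat (x ! (\<pi> d (i + 1)))) *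
            (\<Prod>j<k. of_nat (x ! (m-k+j)) ^ (d ! j) * (1 - of_nat (x ! (m-k+j))) ^ (1 - d ! j)))) | \<pi>.
        \<forall>d\<in>cube k. \<pi> d permutes {..<m-k}}"

section \<open>Polyphase words, weights and distances\<close>

definition xi_pow :: "'h::len word \<Rightarrow> complex" where
  "xi_pow a = exp (2 * of_real pi * \<i> / 2 ^ LENGTH('h)) ^ unat a"

definition polyphase :: "'h::len word vec \<Rightarrow> complex vec" where
  "polyphase c = map_vec xi_pow c"

definition PMEPR :: "real \<Rightarrow> complex vec \<Rightarrow> real" where
  "PMEPR \<zeta> C = 1 / real (dim_vec C) *
     (SUP \<theta>\<in>{0..<1}.
        (cmod (\<Sum>i<dim_vec C. C $ i *
           exp (2 * of_real pi * \<i> * (of_nat i + of_real \<zeta>) * of_real \<theta>)))\<^sup>2)"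

definition lee_weight :: "'h::len word vec \<Rightarrow> nat" where
  "lee_weight a = (\<Sum>i<dim_vec a. min (unat (a $ i)) (2 ^ LENGTH('h) - unat (a $ i)))"

definition sq_euclidean_weight :: "'h::len word vec \<Rightarrow> real" where
  "sq_euclidean_weight a = (\<Sum>i<dim_vec a. (cmod (xi_pow (a $ i) - 1))\<^sup>2)"

definition min_dist :: "('a::minus vec \<Rightarrow> 'b::linorder) \<Rightarrow> 'a vec set \<Rightarrow> 'b" where
  "min_dist wt C = Min {wt (a - b) | a b. a \<in> C \<and> b \<in> C \<and> a \<noteq> b}"

end

(* Effective degree at most rho means that the coefficient of a monomial of degree d is divisible by
   2^(d - rho) for d > rho. Splitting off the first variable turns this into a condition on f(0,.) and
   f(1,.) - f(0,.) with bound rho and rho - 1; by induction the effective degree is subadditive under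
   products, and the triangle inequality for the Lee weight gives Lee distance at least 2^(m-r) for ERM.
   The Euclidean bound follows pointwise from |xi^a - 1|^2 >= 4 sin^2(pi/2^h) * lee(a).
   For fixed values of the last k variables, a word in a coset is 2^(h-1) times a path form plus an
   affine function, hence a Golay sequence; adding up the 2^k slices bounds the PMEPR.
   The (m-k)!/2 path forms on m-k variables are pairwise distinct modulo affine functions, and letting
   the path depend on min(r+h-3, k) of the last variables keeps the effective degree at most r. *)

theory Submission
  imports Defs
begin

section \<open>Effective degree\<close>

text \<open>A quadratic form along a path costs degree 2, the factor 2^(h-1) gains h-1, and the
  indicator of a choice among e variables costs e. The budget e + 2 - (h-1) <= r, with only k
  variables available, gives e = min(r+h-3, k). The paths attached to the 2^e values of these
  variables are chosen independently, which explains the outer exponent; the factor 1/2 is there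
  because a path and its reversal have the same form. Distinctness of the cosets is decided slice by
  slice: a word of A is affine in the first m-k variables once the others are fixed, so two path
  words in one coset have forms that differ by an affine function. For the PMEPR, a Golay slice of
  length 2^(m-k) has modulus at most sqrt(2^(m-k+1)); the triangle inequality over 2^k slices
  squares to 2^(2k+m-k+1), and division by 2^m leaves 2^(k+1). Sharpness for r = r' comes from one
  monomial of degree r' with coefficient 1 in A, which every coset sees as a difference of two of
  its words.\<close>

lemma anf_eqI: "is_anf m f c \<Longrightarrow> anf m f = c"
  unfolding anf_def using ex1_anf[of m f] by (blast intro: the1_equality)

lemma is_anf_anf: "is_anf m f (anf m f)"
  using theI'[OF ex1_anf[of m f]] unfolding anf_def .

lemma anf_cong: "(\<And>x. x \<in> cube m \<Longrightarrow> f x = g x) \<Longrightarrow> anf m f = anf m g"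
  by (simp add: anf_def is_anf_def)

lemma anf_0: "anf 0 f [] = f []"
  using is_anf_anf[of 0 f] by (simp add: is_anf_def cube_0 anf_poly_0)

lemma anf_Suc_0: "anf (Suc m) f (0 # i) = anf m (\<lambda>x. f (0 # x)) i"
proof -
  have "is_anf m (\<lambda>x. f (0 # x)) (\<lambda>i. anf (Suc m) f (0 # i))"
    using is_anf_anf[of "Suc m" f] by (auto simp: is_anf_def cube_Suc anf_poly_Cons image_iff)
  from anf_eqI[OF this] show ?thesis by simp
qed

lemma anf_Suc_1: "anf (Suc m) f (1 # i) = anf m (\<lambda>x. f (1 # x) - f (0 # x)) i"
proof -
  have "is_anf m (\<lambda>x. f (1 # x) - f (0 # x)) (\<lambda>i. anf (Suc m) f (1 # i))"
    using is_anf_anf[of "Suc m" f] by (auto simp: is_anf_def cube_Suc anf_poly_Cons image_iff)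
  from anf_eqI[OF this] show ?thesis by simp
qed

lemma pow2_dvd_word_zero:
  fixes c :: "'h::len word"
  assumes "LENGTH('h) \<le> n"
  shows "2 ^ n dvd c \<longleftrightarrow> c = 0"
proof -
  have "(2::'h word) ^ n = 0" using assms by simp
  then show ?thesis unfolding \<open>2 ^ n = 0\<close> by simp
qed

lemma uint_mod_pow2_eq_0_iff:
  fixes c :: "'h::len word"
  assumes "n \<le> LENGTH('h)"
  shows "uint c mod 2 ^ n = 0 \<longleftrightarrow> 2 ^ n dvd c"
proof -
  have "uint c mod 2 ^ n = uint (take_bit n c)"
    by (simp add: unsigned_take_bit_eq flip: take_bit_eq_mod)
  then show ?thesis by (metis take_bit_eq_0_iff unsigned_eq_0_iff)
qed

text \<open>The effective degree tests only the levels i < h. Nothing is lost for n > h: level h-1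
  already forces c = 0, which every power of 2 divides.\<close>

lemma pow2_dvd_word_iff:
  fixes c :: "'h::len word"
  shows "2 ^ n dvd c \<longleftrightarrow> (\<forall>i<LENGTH('h). i < n \<longrightarrow> 2 ^ (i + 1) dvd c)"
proof
  assume "2 ^ n dvd c"
  then show "\<forall>i<LENGTH('h). i < n \<longrightarrow> 2 ^ (i + 1) dvd c"
    by (auto simp: Suc_le_eq intro: dvd_trans[OF le_imp_power_dvd] simp del: power_Suc)
next
  assume R: "\<forall>i<LENGTH('h). i < n \<longrightarrow> 2 ^ (i + 1) dvd c"
  show "2 ^ n dvd c"
  proof (cases "n = 0 \<or> n \<le> LENGTH('h)")
    case True
    then show ?thesis using R[rule_format, of "n - 1"] by (cases n) auto
  next
    case False
    then have "2 ^ LENGTH('h) dvd c" using R[rule_format, of "LENGTH('h) - 1"] by auto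
    then have "c = 0" by (subst (asm) pow2_dvd_word_zero) auto
    then show ?thesis by simp
  qed
qed

text \<open>Term i of the maximum asks all coefficients of degree above \<open>\<rho> + i\<close> to
  vanish modulo 2^(i+1). For a fixed monomial of degree d the levels i < d - \<open>\<rho>\<close>
  merge into one divisibility; \<open>nat\<close> makes it void when d is at most
  \<open>\<rho>\<close>.\<close>

lemma GBF_iff:
  fixes f :: "nat list \<Rightarrow> 'h::len word"
  shows "f \<in> GBF \<rho> m \<longleftrightarrow> (\<forall>j\<in>cube m. 2 ^ nat (int (sum_list j) - \<rho>) dvd anf m f j)"
proof -
  have "f \<in> GBF \<rho> m \<longleftrightarrow> (\<forall>i<LENGTH('h).
      coeff_degree m (\<lambda>j. uint (anf m f j) mod 2 ^ (i + 1)) - ereal (real i) \<le> ereal (real_of_int \<rho>))"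
    unfolding GBF_def effective_degree_def by (subst mem_Collect_eq, subst Max_le_iff) auto
  also have "\<dots> \<longleftrightarrow> (\<forall>i<LENGTH('h). \<forall>j\<in>cube m. int i < int (sum_list j) - \<rho> \<longrightarrow> 2 ^ (i + 1) dvd anf m f j)"
  proof (intro all_cong)
    fix i assume i: "i < LENGTH('h)"
    have "coeff_degree m (\<lambda>j. uint (anf m f j) mod 2 ^ (i + 1)) - ereal (real i) \<le> ereal (real_of_int \<rho>)
      \<longleftrightarrow> coeff_degree m (\<lambda>j. uint (anf m f j) mod 2 ^ (i + 1)) \<le> ereal (real_of_int (\<rho> + int i))"
      by (subst ereal_minus_le_iff) (auto simp: algebra_simps)
    also have "\<dots> \<longleftrightarrow> (\<forall>j\<in>cube m. uint (anf m f j) mod 2 ^ (i + 1) \<noteq> 0 \<longrightarrow> int (sum_list j) \<le> \<rho> + int i)"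
      unfolding coeff_degree_def SUP_le_iff
    proof (intro iffI ballI impI; clarsimp)
      fix j assume "\<forall>ia. ia \<in> cube m \<and> uint (anf m f ia) mod (2 * 2 ^ i) \<noteq> 0 \<longrightarrow> real (sum_list ia) \<le> real_of_int \<rho> + real i"
       "j \<in> cube m" "uint (anf m f j) mod (2 * 2 ^ i) \<noteq> 0"
      then have "real (sum_list j) \<le> real_of_int \<rho> + real i" by blast
      then show "int (sum_list j) \<le> \<rho> + int i" by linarith
    next
      fix j assume "\<forall>j\<in>cube m. uint (anf m f j) mod (2 * 2 ^ i) \<noteq> 0 \<longrightarrow> int (sum_list j) \<le> \<rho> + int i"
       "j \<in> cube m" "uint (anf m f j) mod (2 * 2 ^ i) \<noteq> 0"
      then have "int (sum_list j) \<le> \<rho> + int i" by blast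
      then show "real (sum_list j) \<le> real_of_int \<rho> + real i" by linarith
    qed
    also have "\<dots> \<longleftrightarrow> (\<forall>j\<in>cube m. int i < int (sum_list j) - \<rho> \<longrightarrow> 2 ^ (i + 1) dvd anf m f j)"
    proof (intro ball_cong refl)
      fix j
      have "uint (anf m f j) mod 2 ^ (i + 1) = 0 \<longleftrightarrow> 2 ^ (i + 1) dvd anf m f j"
        using i by (intro uint_mod_pow2_eq_0_iff) simp
      then show "(uint (anf m f j) mod 2 ^ (i + 1) \<noteq> 0 \<longrightarrow> int (sum_list j) \<le> \<rho> + int i) \<longleftrightarrow>
        (int i < int (sum_list j) - \<rho> \<longrightarrow> 2 ^ (i + 1) dvd anf m f j)"
        by (smt (verit))
    qed
    finally show "coeff_degree m (\<lambda>j. uint (anf m f j) mod 2 ^ (i + 1)) - ereal (real i) \<le> ereal (real_of_int \<rho>)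
      \<longleftrightarrow> (\<forall>j\<in>cube m. int i < int (sum_list j) - \<rho> \<longrightarrow> 2 ^ (i + 1) dvd anf m f j)" .
  qed
  also have "\<dots> \<longleftrightarrow> (\<forall>j\<in>cube m. 2 ^ nat (int (sum_list j) - \<rho>) dvd anf m f j)"
    by (subst pow2_dvd_word_iff) (auto simp: zless_nat_eq_int_zless)
  finally show ?thesis .
qed

section \<open>Recursion on the first variable and closure properties of bounded effective
  degree\<close>

lemma GBF_cong:
  "(\<And>x. x \<in> cube m \<Longrightarrow> f x = g x) \<Longrightarrow> f \<in> GBF \<rho> m \<longleftrightarrow> g \<in> GBF \<rho> m"
  unfolding GBF_iff using anf_cong[of m f g] by simp

lemma GBF_0: "f \<in> GBF \<rho> 0 \<longleftrightarrow> 2 ^ nat (- \<rho>) dvd f []"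
  by (simp add: GBF_iff cube_0 anf_0)

text \<open>The difference is the coefficient of the first variable, whose monomials have one degree
  less. Later closure proofs run on this recursion and no longer touch coefficients. The bound may
  drop below 0, where it demands divisibility even of constants.\<close>

lemma GBF_Suc:
  "f \<in> GBF \<rho> (Suc m) \<longleftrightarrow>
     (\<lambda>x. f (0 # x)) \<in> GBF \<rho> m \<and> (\<lambda>x. f (1 # x) - f (0 # x)) \<in> GBF (\<rho> - 1) m"
proof -
  have "int (1 + s) - \<rho> = int s - (\<rho> - 1)" for s by simp
  then show ?thesis
    unfolding GBF_iff cube_Suc ball_Un ball_simps
    by (simp only: anf_Suc_0 anf_Suc_1 sum_list.Cons add_0)
qed

lemma GBF_mono: "f \<in> GBF \<rho> m \<Longrightarrow> \<rho> \<le> \<sigma> \<Longrightarrow> f \<in> GBF \<sigma> m"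
  unfolding GBF_iff by (meson diff_left_mono dvd_trans le_imp_power_dvd nat_mono)

lemma GBF_add: "f \<in> GBF \<rho> m \<Longrightarrow> g \<in> GBF \<rho> m \<Longrightarrow> (\<lambda>x. f x + g x) \<in> GBF \<rho> m"
proof (induction m arbitrary: f g \<rho>)
  case (Suc m)
  from Suc.prems show ?case
    unfolding GBF_Suc by (auto simp: add_diff_add intro: Suc.IH)
qed (auto simp: GBF_0)

lemma GBF_uminus: "f \<in> GBF \<rho> m \<Longrightarrow> (\<lambda>x. - f x) \<in> GBF \<rho> m"
proof (induction m arbitrary: f \<rho>)
  case (Suc m)
  have "(\<lambda>x. - f (1 # x) - - f (0 # x)) = (\<lambda>x. - (f (1 # x) - f (0 # x)))" by simp
  with Suc show ?case by (simp only: GBF_Suc)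
qed (auto simp: GBF_0)

lemma GBF_diff: "f \<in> GBF \<rho> m \<Longrightarrow> g \<in> GBF \<rho> m \<Longrightarrow> (\<lambda>x. f x - g x) \<in> GBF \<rho> m"
  using GBF_add[OF _ GBF_uminus, of f \<rho> m g] by simp

text \<open>Divisibility by 2^j pushes a constant down to bound -j; this is how the factor 2^(h-1)
  gains h-1 units of degree.\<close>

lemma GBF_const: "2 ^ nat (- \<rho>) dvd c \<Longrightarrow> (\<lambda>x. c) \<in> GBF \<rho> m"
proof (induction m arbitrary: c \<rho>)
  case (Suc m)
  then show ?case unfolding GBF_Suc by auto
qed (auto simp: GBF_0)

lemma GBF_sum:
  "(\<And>i. i \<in> I \<Longrightarrow> f i \<in> GBF \<rho> m) \<Longrightarrow> (\<lambda>x. \<Sum>i\<in>I. f i x) \<in> GBF \<rho> m"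
  by (induction I rule: infinite_finite_induct) (auto intro: GBF_const GBF_add)

text \<open>With D the difference in the first variable, D(fg) = f0 Dg + Df Dg + Df g0, and each of
  the three products has bound \<open>\<rho> + \<sigma> - 1\<close> by induction.\<close>

lemma GBF_mult: "f \<in> GBF \<rho> m \<Longrightarrow> g \<in> GBF \<sigma> m \<Longrightarrow> (\<lambda>x. f x * g x) \<in> GBF (\<rho> + \<sigma>) m"
proof (induction m arbitrary: f g \<rho> \<sigma>)
  case 0
  have "nat (- (\<rho> + \<sigma>)) \<le> nat (- \<rho>) + nat (- \<sigma>)" by simp
  then have "2 ^ nat (- (\<rho> + \<sigma>)) dvd (2::'a word) ^ nat (- \<rho>) * 2 ^ nat (- \<sigma>)"
    by (metis le_imp_power_dvd power_add)
  with 0 show ?case unfolding GBF_0 by (meson dvd_trans mult_dvd_mono)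
next
  case (Suc m)
  let ?f0 = "\<lambda>x. f (0 # x)" and ?g0 = "\<lambda>x. g (0 # x)"
  let ?f1 = "\<lambda>x. f (1 # x) - f (0 # x)" and ?g1 = "\<lambda>x. g (1 # x) - g (0 # x)"
  have fg: "?f0 \<in> GBF \<rho> m" "?f1 \<in> GBF (\<rho> - 1) m" "?g0 \<in> GBF \<sigma> m" "?g1 \<in> GBF (\<sigma> - 1) m"
    using Suc.prems by (auto simp: GBF_Suc)
  \<comment> \<open>The second-order product would even allow \<open>\<rho> + \<sigma> - 2\<close>;
    weakening one factor gives it the same bound as the other two.\<close>
  have f1: "?f1 \<in> GBF \<rho> m" by (rule GBF_mono[OF fg(2)]) simp
  have a: "(\<lambda>x. ?f0 x * ?g1 x) \<in> GBF (\<rho> + \<sigma> - 1) m"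
    using Suc.IH[OF fg(1) fg(4)] by (simp add: add_diff_eq)
  have b: "(\<lambda>x. ?f1 x * ?g1 x) \<in> GBF (\<rho> + \<sigma> - 1) m"
    using Suc.IH[OF f1 fg(4)] by (simp add: add_diff_eq)
  have c: "(\<lambda>x. ?f1 x * ?g0 x) \<in> GBF (\<rho> + \<sigma> - 1) m"
    using Suc.IH[OF fg(2) fg(3)] by (simp add: algebra_simps)
  have "(\<lambda>x. f (1 # x) * g (1 # x) - f (0 # x) * g (0 # x)) =
      (\<lambda>x. ?f0 x * ?g1 x + (?f1 x * ?g1 x + ?f1 x * ?g0 x))"
    by (simp add: algebra_simps)
  then show ?case
    using Suc.IH[OF fg(1) fg(3)] GBF_add[OF a GBF_add[OF b c]] by (simp add: GBF_Suc)
qed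

lemma GBF_prod:
  "finite I \<Longrightarrow> (\<And>i. i \<in> I \<Longrightarrow> f i \<in> GBF 1 m) \<Longrightarrow> (\<lambda>x. \<Prod>i\<in>I. f i x) \<in> GBF (int (card I)) m"
proof (induction I rule: finite_induct)
  case (insert i I)
  have "(\<lambda>x. f i x * (\<Prod>i\<in>I. f i x)) \<in> GBF (1 + int (card I)) m"
    by (rule GBF_mult) (use insert in auto)
  then show ?case using insert by simp
qed (auto intro: GBF_const)

lemma GBF_coordinate: "i < m \<Longrightarrow> (\<lambda>x. of_nat (x ! i)) \<in> GBF 1 m"
proof (induction m arbitrary: i)
  case (Suc m)
  then show ?case by (cases i) (auto simp: GBF_Suc intro: GBF_const)
qed simp

lemma GBF_drop: "g \<in> GBF \<rho> k \<Longrightarrow> (\<lambda>x. g (drop n x)) \<in> GBF \<rho> (n + k)"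
  by (induction n) (auto simp: GBF_Suc intro: GBF_const)

section \<open>Words\<close>

definition index_of :: "nat \<Rightarrow> nat list \<Rightarrow> nat" where
  "index_of m x = (\<Sum>\<alpha><m. x ! \<alpha> * 2 ^ \<alpha>)"

lemma bits_of_Suc: "bits_of (Suc m) i = (i mod 2) # bits_of m (i div 2)"
  by (simp add: bits_of_def upt_rec[of 0] div_mult2_eq mult.commute flip: map_Suc_upt del: upt_Suc)

lemma index_of_Cons: "index_of (Suc m) (a # x) = a + 2 * index_of m x"
  unfolding index_of_def sum.lessThan_Suc_shift by (simp add: sum_distrib_left mult_ac)

lemma bits_of_in_cube: "bits_of m i \<in> cube m"
  by (auto simp: bits_of_def cube_def)

lemma index_of_bits_of: "i < 2 ^ m \<Longrightarrow> index_of m (bits_of m i) = i"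
proof (induction m arbitrary: i)
  case (Suc m)
  then have "i div 2 < 2 ^ m" by auto
  then show ?case by (simp add: bits_of_Suc index_of_Cons Suc.IH)
qed (simp add: index_of_def)

lemma bits_of_index_of:
  "x \<in> cube m \<Longrightarrow> bits_of m (index_of m x) = x \<and> index_of m x < 2 ^ m"
proof (induction m arbitrary: x)
  case 0
  then show ?case by (simp add: cube_0 bits_of_def index_of_def)
next
  case (Suc m)
  then show ?case by (fastforce simp: cube_Suc bits_of_Suc index_of_Cons)
qed

lemma bij_betw_bits_of: "bij_betw (bits_of m) {..<2 ^ m} (cube m)"
  by (rule bij_betw_byWitness[where f' = "index_of m"])
    (auto simp: index_of_bits_of bits_of_index_of bits_of_in_cube)

lemma sum_bits_of: "(\<Sum>i<2 ^ m. F (bits_of m i)) = (\<Sum>x\<in>cube m. F x)"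
  by (rule sum.reindex_bij_betw[OF bij_betw_bits_of])

lemma dim_psi [simp]: "dim_vec (psi m f) = 2 ^ m"
  by (simp add: psi_def)

lemma psi_carrier [simp]: "psi m f \<in> carrier_vec (2 ^ m)"
  by (simp add: psi_def)

lemma psi_index_of: "x \<in> cube m \<Longrightarrow> psi m f $ index_of m x = f x"
  by (simp add: psi_def bits_of_index_of)

lemma psi_eq_iff: "psi m f = psi m g \<longleftrightarrow> (\<forall>x\<in>cube m. f x = g x)"
proof
  assume "psi m f = psi m g"
  then show "\<forall>x\<in>cube m. f x = g x" by (metis psi_index_of)
qed (auto simp: psi_def bits_of_in_cube)

lemma psi_add: "psi m f + psi m g = psi m (\<lambda>x. f x + g x)"
  by (auto simp: psi_def)

lemma psi_diff: "psi m f - psi m g = psi m (\<lambda>x. f x - g x)"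
  by (auto simp: psi_def)

lemma carrier_vec_psi:
  assumes "w \<in> carrier_vec (2 ^ m)"
  obtains f where "w = psi m f"
proof
  show "w = psi m (\<lambda>x. w $ index_of m x)"
    using assms by (intro eq_vecI) (auto simp: psi_def index_of_bits_of)
qed

lemma psi_in_ERM_iff: "psi m f \<in> ERM \<rho> m \<longleftrightarrow> f \<in> GBF \<rho> m"
proof
  assume "psi m f \<in> ERM \<rho> m"
  then show "f \<in> GBF \<rho> m"
    unfolding ERM_def image_iff psi_eq_iff using GBF_cong by blast
qed (simp add: ERM_def)

lemma word_effective_degree_psi_le_iff:
  "word_effective_degree m (psi m f) \<le> ereal (real r) \<longleftrightarrow> f \<in> GBF (int r) m"
proof -
  have "word_effective_degree m (psi m f) \<le> ereal (real r) \<longleftrightarrow>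
      (\<lambda>x. psi m f $ index_of m x) \<in> GBF (int r) m"
    by (simp add: word_effective_degree_def GBF_def index_of_def)
  also have "\<dots> \<longleftrightarrow> f \<in> GBF (int r) m"
    by (rule GBF_cong) (simp add: psi_index_of)
  finally show ?thesis .
qed

section \<open>Lee and Euclidean weights\<close>

definition lee :: "'h::len word \<Rightarrow> nat" where
  "lee a = min (unat a) (2 ^ LENGTH('h) - unat a)"

lemma lee_weight_psi: "lee_weight (psi m f) = (\<Sum>x\<in>cube m. lee (f x))"
  unfolding lee_weight_def lee_def dim_psi sum_bits_of[symmetric]
  by (rule sum.cong) (auto simp: psi_def)

lemma sq_euclidean_weight_psi:
  "sq_euclidean_weight (psi m f) = (\<Sum>x\<in>cube m. (cmod (xi_pow (f x) - 1))\<^sup>2)"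
  unfolding sq_euclidean_weight_def dim_psi sum_bits_of[symmetric]
  by (rule sum.cong) (auto simp: psi_def)

lemma lee_0 [simp]: "lee 0 = 0"
  by (simp add: lee_def)

lemma lee_1 [simp]: "lee (1 :: 'h::len word) = 1"
proof -
  have "(2::nat) ^ 1 \<le> 2 ^ LENGTH('h)" by (rule power_increasing) (auto simp: Suc_le_eq)
  then show ?thesis by (simp add: lee_def)
qed

text \<open>This is the triangle inequality for b = (a + b) - a with the symmetry of the Lee weight
  built in; it is checked on representatives, with and without wrap-around at 2^h.\<close>

lemma lee_le_add_diff:
  fixes a b :: "'h::len word"
  shows "lee b \<le> lee a + lee (a + b)"
proof -
  have "min B (N - B) \<le> min A (N - A) + (if A + B < N then min (A + B) (N - (A + B))
      else min (A + B - N) (N - (A + B - N)))" if "A < N" "B < N" for A B N :: nat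
    using that by (cases "A + B < N") (auto simp: min_def)
  from this[where A = "unat a" and B = "unat b" and N = "2 ^ LENGTH('h)", OF unsigned_less unsigned_less]
  show ?thesis unfolding lee_def unat_plus_if' by (simp split: if_splits)
qed

text \<open>Here n < h, since otherwise a = 0. So 2^n divides both the representative and its
  complement to 2^h, and both are positive.\<close>

lemma pow2_le_lee:
  fixes a :: "'h::len word"
  assumes "2 ^ n dvd a" "a \<noteq> 0"
  shows "2 ^ n \<le> lee a"
proof -
  have n: "n < LENGTH('h)" using assms pow2_dvd_word_zero[of n a] by (meson not_le)
  have "int (2 ^ n) dvd int (unat a)"
    using uint_mod_pow2_eq_0_iff[of n a] assms(1) n by (auto simp: dvd_eq_mod_eq_0)
  then have d: "2 ^ n dvd unat a" by (simp only: int_dvd_int_iff)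
  have "2 ^ n dvd (2::nat) ^ LENGTH('h)" using n by (intro le_imp_power_dvd) simp
  with d have "2 ^ n dvd 2 ^ LENGTH('h) - unat a" by (rule dvd_diff_nat[rotated])
  moreover have "unat a < 2 ^ LENGTH('h)" by (rule unsigned_less)
  moreover have "unat a > 0" using assms(2) by (simp add: unat_gt_0)
  ultimately show ?thesis using d unfolding lee_def by (meson dvd_imp_le min.boundedI zero_less_diff)
qed

text \<open>If the two halves differ somewhere, their difference has bound \<open>\<rho> - 1\<close>
  and hence already the required weight, since (m+1) - \<open>\<rho>\<close> = m -
  (\<open>\<rho>\<close> - 1); the triangle inequality passes it to f. If they agree, the weight of
  one half is doubled. A real power is used because \<open>\<rho>\<close> may exceed the number of
  variables during the induction.\<close>

lemma lee_sum_ge: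
  assumes "f \<in> GBF \<rho> m" "x \<in> cube m" "f x \<noteq> 0"
  shows "2 powr (real m - real_of_int \<rho>) \<le> real (\<Sum>x\<in>cube m. lee (f x))"
  using assms
proof (induction m arbitrary: f x \<rho>)
  case 0
  then have "2 ^ nat (- \<rho>) \<le> lee (f [])" by (intro pow2_le_lee) (auto simp: GBF_0 cube_0)
  then have "2 ^ nat (- \<rho>) \<le> real (lee (f []))"
    by (metis of_nat_le_iff of_nat_numeral of_nat_power)
  moreover have "2 powr (- real_of_int \<rho>) \<le> 2 powr real (nat (- \<rho>))" by simp
  then have "2 powr (- real_of_int \<rho>) \<le> 2 ^ nat (- \<rho>)" by (simp add: powr_realpow)
  ultimately have "2 powr (- real_of_int \<rho>) \<le> real (lee (f []))" by linarith
  then show ?case by (simp add: cube_0)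
next
  case (Suc m)
  let ?f0 = "\<lambda>x. f (0 # x)" and ?g = "\<lambda>x. f (1 # x) - f (0 # x)"
  have f: "?f0 \<in> GBF \<rho> m" "?g \<in> GBF (\<rho> - 1) m" using Suc.prems(1) by (auto simp: GBF_Suc)
  have s: "(\<Sum>x\<in>cube (Suc m). lee (f x)) = (\<Sum>x\<in>cube m. lee (f (0 # x)) + lee (f (1 # x)))"
    unfolding cube_Suc
    by (subst sum.union_disjoint) (auto simp: finite_cube sum.reindex sum.distrib)
  show ?case
  proof (cases "\<exists>y\<in>cube m. ?g y \<noteq> 0")
    case True
    then obtain y where "y \<in> cube m" "?g y \<noteq> 0" by blast
    from Suc.IH[OF f(2) this]
    have "2 powr (real (Suc m) - real_of_int \<rho>) \<le> real (\<Sum>x\<in>cube m. lee (?g x))"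
      by (simp add: algebra_simps)
    also have "\<dots> \<le> real (\<Sum>x\<in>cube (Suc m). lee (f x))"
      unfolding s of_nat_le_iff
    proof (rule sum_mono)
      fix y show "lee (?g y) \<le> lee (f (0 # y)) + lee (f (1 # y))"
        using lee_le_add_diff[of "?g y" "f (0 # y)"] by simp
    qed
    finally show ?thesis .
  next
    case False
    then have g: "f (1 # y) = f (0 # y)" if "y \<in> cube m" for y using that by auto
    from Suc.prems(2,3) g obtain y where "y \<in> cube m" "?f0 y \<noteq> 0"
      by (auto simp: cube_Suc)
    from Suc.IH[OF f(1) this]
    have "2 * 2 powr (real m - real_of_int \<rho>) \<le> real (2 * (\<Sum>x\<in>cube m. lee (?f0 x)))"
      by simp
    also have "2 * (\<Sum>x\<in>cube m. lee (?f0 x)) = (\<Sum>x\<in>cube (Suc m). lee (f x))"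
      unfolding s sum_distrib_left using g by (intro sum.cong) auto
    also have "2 * 2 powr (real m - real_of_int \<rho>) = 2 powr (1 + (real m - real_of_int \<rho>))"
      by (simp only: powr_add) simp
    finally show ?thesis by (simp add: algebra_simps)
  qed
qed

text \<open>Each step from a to a+1 adds 2 sin(ay + y/2) sin(y/2), which is at least 2 sin(y/2)^2 =
  1 - cos y as long as ay + y/2 stays between y/2 and pi - y/2.\<close>

lemma one_minus_cos_mult_ge:
  fixes y :: real
  assumes "0 \<le> y" "real a * y \<le> pi"
  shows "real a * (1 - cos y) \<le> 1 - cos (real a * y)"
  using assms(2)
proof (induction a)
  case (Suc a)
  have a: "real a * y \<le> pi" "real a * y + y \<le> pi"
    using Suc.prems assms(1) by (auto simp: algebra_simps)
  have p: "0 \<le> real a * y" using assms(1) by simp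
  have "sin (y / 2) \<le> sin (y / 2 + real a * y)"
  proof (cases "y / 2 + real a * y \<le> pi / 2")
    case True
    then show ?thesis using assms(1) p pi_gt_zero by (intro sin_monotone_2pi_le) linarith+
  next
    case False
    \<comment> \<open>Beyond pi/2 the angle is reflected; (a+1)y <= pi keeps its mirror image at or
      above y/2.\<close>
    have "sin (y / 2) \<le> sin (pi - (y / 2 + real a * y))"
      using assms(1) p a False pi_gt_zero by (intro sin_monotone_2pi_le) linarith+
    then show ?thesis by simp
  qed
  moreover have "0 \<le> sin (y / 2)"
    using assms(1) a p pi_gt_zero by (intro sin_ge_zero) linarith+
  ultimately have "2 * sin (y / 2) * sin (y / 2) \<le> 2 * sin (y / 2 + real a * y) * sin (y / 2)"
    by (simp add: mult_right_mono)
  also have "2 * sin (y / 2 + real a * y) * sin (y / 2) = cos (real a * y) - cos (real (Suc a) * y)"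
    by (subst cos_diff_cos) (simp add: field_simps)
  also have "2 * sin (y / 2) * sin (y / 2) = 1 - cos y"
    using cos_double_sin[of "y / 2"] by (simp add: power2_eq_square)
  finally show ?case using Suc.IH[OF a(1)] by (simp add: algebra_simps)
qed simp

lemma xi_pow_cis: "xi_pow (a :: 'h::len word) = cis (real (unat a) * (2 * pi / 2 ^ LENGTH('h)))"
proof -
  have "exp (2 * of_real pi * \<i> / 2 ^ LENGTH('h)) = cis (2 * pi / 2 ^ LENGTH('h))"
    by (simp add: cis_conv_exp field_simps)
  then show ?thesis unfolding xi_pow_def by (simp add: DeMoivre)
qed

lemma cmod_cis_minus_1: "(cmod (cis t - 1))\<^sup>2 = 2 * (1 - cos t)"
proof -
  have "(cmod (cis t - 1))\<^sup>2 = (cos t - 1)\<^sup>2 + (sin t)\<^sup>2"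
    by (simp add: cmod_power2)
  also have "\<dots> = 2 * (1 - cos t)" unfolding sin_squared_eq by (simp add: power2_eq_square algebra_simps)
  finally show ?thesis .
qed

lemma one_minus_cos_2pi_div: "2 * (1 - cos (2 * pi / n)) = 4 * (sin (pi / n))\<^sup>2" for n :: real
  using cos_double_sin[of "pi / n"] by simp

text \<open>The cosine does not distinguish a from its negative, so the representative can be
  replaced by the Lee weight; the squared distance then grows at least linearly in it. The constant
  is the value at Lee weight 1.\<close>

lemma sq_euclidean_ge_lee:
  fixes a :: "'h::len word"
  shows "4 * (sin (pi / 2 ^ LENGTH('h)))\<^sup>2 * real (lee a) \<le> (cmod (xi_pow a - 1))\<^sup>2"
proof -
  define N :: real where "N = 2 ^ LENGTH('h)"
  define y where "y = 2 * pi / N"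
  have N: "N > 0" "N = real (2 ^ LENGTH('h))" by (auto simp: N_def)
  have lt: "unat a < 2 ^ LENGTH('h)" by (rule unsigned_less)
  have c: "cos (real (unat a) * y) = cos (real (lee a) * y)"
  proof (cases "lee a = unat a")
    case False
    then have "lee a = 2 ^ LENGTH('h) - unat a" by (auto simp: lee_def)
    then have "lee a + unat a = 2 ^ LENGTH('h)" using lt by linarith
    then have "real (lee a) + real (unat a) = N" unfolding N(2) by (metis of_nat_add)
    then have "(real (lee a) + real (unat a)) * y = 2 * pi" using N(1) by (simp only: y_def) simp
    then have "real (lee a) * y = 2 * pi - real (unat a) * y" by (simp add: algebra_simps)
    then show ?thesis by simp
  qed simp
  \<comment> \<open>The smaller of a and 2^h - a is at most half of 2^h, which keeps the angle
    within [0, pi].\<close>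
  have "2 * lee a \<le> 2 ^ LENGTH('h)" by (auto simp: lee_def)
  then have "real (2 * lee a) \<le> N" unfolding N(2) of_nat_le_iff .
  then have "real (lee a) * y \<le> pi" using N(1) by (simp add: y_def field_simps)
  then have "real (lee a) * (1 - cos y) \<le> 1 - cos (real (lee a) * y)"
    using N(1) by (intro one_minus_cos_mult_ge) (auto simp: y_def)
  moreover have "(cmod (xi_pow a - 1))\<^sup>2 = 2 * (1 - cos (real (lee a) * y))"
    unfolding xi_pow_cis cmod_cis_minus_1 c[unfolded y_def N_def] y_def N_def ..
  moreover have "4 * (sin (pi / N))\<^sup>2 = 2 * (1 - cos y)"
    unfolding y_def one_minus_cos_2pi_div ..
  then have "4 * (sin (pi / N))\<^sup>2 * real (lee a) = 2 * (real (lee a) * (1 - cos y))" by simp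
  ultimately show ?thesis
    unfolding N_def[symmetric] by (simp only: mult_le_cancel_left_pos zero_less_numeral)
qed

section \<open>The additive character \<open>xi_pow\<close>\<close>

lemma xi_pow_1: "(cmod (xi_pow (1 :: 'h::len word) - 1))\<^sup>2 = 4 * (sin (pi / 2 ^ LENGTH('h)))\<^sup>2"
  unfolding xi_pow_cis cmod_cis_minus_1 by (simp flip: one_minus_cos_2pi_div)

lemma xi_pow_0 [simp]: "xi_pow 0 = 1"
  by (simp add: xi_pow_def)

lemma xi_pow_add: "xi_pow (a + b) = xi_pow a * xi_pow (b :: 'h::len word)"
proof -
  define \<xi> :: complex where "\<xi> = exp (2 * of_real pi * \<i> / 2 ^ LENGTH('h))"
  have 1: "\<xi> ^ 2 ^ LENGTH('h) = 1"
    by (simp add: \<xi>_def flip: exp_of_nat_mult)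
  have "unat a + unat b = 2 ^ LENGTH('h) * ((unat a + unat b) div 2 ^ LENGTH('h)) + unat (a + b)"
    by (simp add: unat_word_ariths)
  then have "\<xi> ^ (unat a + unat b) = (\<xi> ^ 2 ^ LENGTH('h)) ^ ((unat a + unat b) div 2 ^ LENGTH('h)) * \<xi> ^ unat (a + b)"
    by (metis power_add power_mult)
  then show ?thesis by (simp add: xi_pow_def power_add 1 flip: \<xi>_def)
qed

lemma xi_pow_sum: "xi_pow (\<Sum>i\<in>I. f i) = (\<Prod>i\<in>I. xi_pow (f i))"
  by (induction I rule: infinite_finite_induct) (auto simp: xi_pow_add)

lemma cmod_xi_pow [simp]: "cmod (xi_pow a) = 1"
  by (simp add: xi_pow_cis)

lemma xi_pow_of_nat_mult: "xi_pow (of_nat n * a) = xi_pow a ^ n"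
  by (induction n) (auto simp: xi_pow_add algebra_simps)

text \<open>Therefore 2^(h-1) times a path form contributes to the polyphase word only a sign,
  whatever h is.\<close>

lemma xi_pow_half: "xi_pow (2 ^ (LENGTH('h) - 1) :: 'h::len word) = -1"
proof -
  have "unat (2 ^ (LENGTH('h) - 1) :: 'h word) = 2 ^ (LENGTH('h) - 1)"
    
    using unat_of_nat[where 'a = 'h, of "2 ^ (LENGTH('h) - 1)"] by simp
  moreover have "(2::real) ^ LENGTH('h) = 2 * 2 ^ (LENGTH('h) - 1)"
    by (simp flip: power_Suc)
  ultimately show ?thesis by (simp add: xi_pow_cis complex_eq_iff)
qed

section \<open>Peak power\<close>

lemma card_cube: "card (cube m) = 2 ^ m"
  using bij_betw_same_card[OF bij_betw_bits_of[of m]] by simp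

lemma length_cube: "x \<in> cube m \<Longrightarrow> length x = m"
  by (simp add: cube_def)

lemma nth_cube: "x \<in> cube m \<Longrightarrow> i < m \<Longrightarrow> x ! i = 0 \<or> x ! i = 1"
  unfolding cube_def by (auto dest: nth_mem)

lemma append_in_cube: "u \<in> cube n \<Longrightarrow> v \<in> cube k \<Longrightarrow> u @ v \<in> cube (n + k)"
  by (auto simp: cube_def)

lemma take_in_cube: "x \<in> cube m \<Longrightarrow> n \<le> m \<Longrightarrow> take n x \<in> cube n"
  by (auto simp: cube_def dest: in_set_takeD)

lemma drop_in_cube: "x \<in> cube m \<Longrightarrow> n \<le> m \<Longrightarrow> drop n x \<in> cube (m - n)"
  by (auto simp: cube_def dest: in_set_dropD)

lemma sum_cube_append:
  "(\<Sum>x\<in>cube (n + k). F x) = (\<Sum>v\<in>cube k. \<Sum>u\<in>cube n. F (u @ v))"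
proof -
  have "(\<Sum>v\<in>cube k. \<Sum>u\<in>cube n. F (u @ v)) = (\<Sum>(v, u)\<in>cube k \<times> cube n. F (u @ v))"
    by (simp add: sum.cartesian_product)
  also have "\<dots> = (\<Sum>x\<in>cube (n + k). F x)"
  proof (rule sum.reindex_bij_witness[where i = "\<lambda>x. (drop n x, take n x)" and j = "\<lambda>(v, u). u @ v"])
    fix x assume x: "x \<in> cube (n + k)"
    show "(drop n x, take n x) \<in> cube k \<times> cube n"
      using take_in_cube[OF x] drop_in_cube[OF x, of n] by simp
  qed (auto simp: length_cube append_in_cube)
  finally show ?thesis ..
qed

text \<open>The product in \<open>words_R\<close> is thus the indicator of one slice, and a sum over
  \<open>d\<close> picks the summand belonging to the last k coordinates.\<close>

lemma cube_indicator:
  assumes "y \<in> cube k" "d \<in> cube k"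
  shows "(\<Prod>j<k. of_nat (y ! j) ^ (d ! j) * (1 - of_nat (y ! j)) ^ (1 - d ! j)) =
    (if d = y then 1 else 0 :: 'a::comm_ring_1)"
proof -
  have t: "of_nat (y ! j) ^ (d ! j) * (1 - of_nat (y ! j)) ^ (1 - d ! j) =
      (if d ! j = y ! j then 1 else 0 :: 'a)" if "j < k" for j
    using nth_cube[OF assms(1) that] nth_cube[OF assms(2) that] by auto
  show ?thesis
  proof (cases "d = y")
    case True
    then show ?thesis using t by simp
  next
    case False
    then obtain j where "j < k" "d ! j \<noteq> y ! j"
      using assms by (metis length_cube nth_equalityI)
    then show ?thesis using False t by (auto intro!: prod_zero)
  qed
qed

text \<open>Valued in the naturals so that it can serve both as an exponent of -1 and, through
  \<open>of_nat\<close>, as an element of the word ring.\<close>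

definition path_form :: "nat \<Rightarrow> (nat \<Rightarrow> nat) \<Rightarrow> nat list \<Rightarrow> nat" where
  "path_form n p x = (\<Sum>i<n-1. x ! p i * x ! p (i + 1))"

text \<open>The values s = 0 and s = 1 give the two members of a Golay pair. The free weights
  \<open>w\<close> absorb both the exponential of the power spectrum and the linear part of a
  slice.\<close>

definition golay_sum :: "nat \<Rightarrow> nat \<Rightarrow> (nat \<Rightarrow> complex) \<Rightarrow> complex" where
  "golay_sum n s w = (\<Sum>u\<in>cube n. (-1) ^ (s * u ! 0 + path_form n id u) * (\<Prod>i<n. w i ^ (u ! i)))"

lemma path_form_Cons: "path_form (Suc (Suc n)) id (a # u) = a * u ! 0 + path_form (Suc n) id u"
  unfolding path_form_def by (simp add: sum.lessThan_Suc_shift del: sum.lessThan_Suc)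

text \<open>Setting the first variable to 1 turns the edge to its neighbour into a linear term,
  which is exactly the companion s = 1 on the remaining variables.\<close>

lemma golay_sum_Suc:
  "golay_sum (Suc (Suc n)) s w =
     golay_sum (Suc n) 0 (w \<circ> Suc) + (-1) ^ s * w 0 * golay_sum (Suc n) 1 (w \<circ> Suc)"
  unfolding golay_sum_def cube_Suc[of "Suc n"]
  by (subst sum.union_disjoint)
    (auto simp: finite_cube sum.reindex path_form_Cons prod.lessThan_Suc_shift sum_distrib_left
       power_add mult_ac simp del: prod.lessThan_Suc)

text \<open>By the recursion the pair (a, b) becomes (a + w0 b, a - w0 b); the parallelogram law
  doubles the sum of squares when |w0| = 1.\<close>

lemma golay_complementary:
  assumes "\<And>i. cmod (w i) = 1"
  shows "(cmod (golay_sum (Suc n) 0 w))\<^sup>2 + (cmod (golay_sum (Suc n) 1 w))\<^sup>2 = 2 ^ (n + 2)"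
  using assms
proof (induction n arbitrary: w)
  have parallelogram: "(cmod (a + b))\<^sup>2 + (cmod (a - b))\<^sup>2 = 2 * ((cmod a)\<^sup>2 + (cmod b)\<^sup>2)" for a b
    unfolding cmod_power2 by (simp add: power2_eq_square algebra_simps)
  {
    case 0
    have "golay_sum (Suc 0) 0 w = 1 + w 0" "golay_sum (Suc 0) 1 w = 1 - w 0"
      by (auto simp: golay_sum_def cube_Suc cube_0 path_form_def)
    then show ?case using parallelogram[of 1 "w 0"] 0 by simp
  next
    case (Suc n)
    let ?a = "golay_sum (Suc n) 0 (w \<circ> Suc)" and ?b = "golay_sum (Suc n) 1 (w \<circ> Suc)"
    have "golay_sum (Suc (Suc n)) 0 w = ?a + w 0 * ?b" "golay_sum (Suc (Suc n)) 1 w = ?a - w 0 * ?b"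
      by (simp_all add: golay_sum_Suc)
    then have "(cmod (golay_sum (Suc (Suc n)) 0 w))\<^sup>2 + (cmod (golay_sum (Suc (Suc n)) 1 w))\<^sup>2 =
        2 * ((cmod ?a)\<^sup>2 + (cmod ?b)\<^sup>2)"
      using Suc.prems by (simp only: parallelogram norm_mult) simp
    also have "(cmod ?a)\<^sup>2 + (cmod ?b)\<^sup>2 = 2 ^ (n + 2)"
      using Suc.prems by (intro Suc.IH) simp
    finally show ?case by simp
  }
qed

text \<open>Relabelling the coordinates moves the permutation from the form to the weights, so only
  the standard path needs to be analysed.\<close>

lemma permuted_path_sum:
  assumes p: "p permutes {..<n}"
  shows "(\<Sum>u\<in>cube n. (-1) ^ path_form n p u * (\<Prod>i<n. w i ^ (u ! i))) = golay_sum n 0 (w \<circ> p)"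
proof -
  let ?T = "\<lambda>q u. map (\<lambda>i. u ! q i) [0..<n]"
  have T: "?T q u \<in> cube n" if q: "q permutes {..<n}" and u: "u \<in> cube n" for q u
  proof -
    have "u ! q i \<in> {0, 1}" if "i < n" for i
      using nth_cube[OF u, of "q i"] permutes_in_image[OF q, of i] that by simp
    then have "(\<lambda>i. u ! q i) ` {i. i < n} \<subseteq> {0, 1}"
      by (intro image_subsetI) (simp only: mem_Collect_eq)
    moreover have "set (?T q u) = (\<lambda>i. u ! q i) ` {i. i < n}" by auto
    ultimately show ?thesis by (simp only: cube_def mem_Collect_eq) simp
  qed
  have pl: "p i < n" "inv_into UNIV p i < n" if "i < n" for i
    using permutes_in_image[OF p, of i] permutes_in_image[OF permutes_inv[OF p], of i] that by auto
  show ?thesis unfolding golay_sum_def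
  proof (rule sum.reindex_bij_witness[where i = "?T (inv_into UNIV p)" and j = "?T p"])
    fix u assume u: "u \<in> cube n"
    show "?T (inv_into UNIV p) (?T p u) = u"
      using u pl permutes_inverses[OF p] by (intro nth_equalityI) (auto simp: length_cube)
    show "?T p (?T (inv_into UNIV p) u) = u"
      using u pl permutes_inverses[OF p] by (intro nth_equalityI) (auto simp: length_cube)
    show "?T p u \<in> cube n" "?T (inv_into UNIV p) u \<in> cube n"
      using u T p permutes_inv[OF p] by auto
    have "path_form n id (?T p u) = path_form n p u"
      unfolding path_form_def by (intro sum.cong) auto
    moreover have "(\<Prod>i<n. (w \<circ> p) i ^ (?T p u ! i)) = (\<Prod>i<n. w i ^ (u ! i))"
      using prod.permute[OF p, of "\<lambda>i. w i ^ (u ! i)"] by (simp add: o_def)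
    ultimately show "(-1) ^ (0 * ?T p u ! 0 + path_form n id (?T p u)) *
        (\<Prod>i<n. (w \<circ> p) i ^ (?T p u ! i)) = (-1) ^ path_form n p u * (\<Prod>i<n. w i ^ (u ! i))"
      by simp
  qed
qed

lemma cmod_permuted_path_sum_le:
  assumes "p permutes {..<n}" "0 < n" "\<And>i. cmod (w i) = 1"
  shows "cmod (\<Sum>u\<in>cube n. (-1) ^ path_form n p u * (\<Prod>i<n. w i ^ (u ! i))) \<le> sqrt (2 ^ (n + 1))"
proof -
  obtain n' where n: "n = Suc n'" using assms(2) by (cases n) auto
  have "(cmod (golay_sum n 0 (w \<circ> p)))\<^sup>2 \<le> 2 ^ (n + 1)"
    using golay_complementary[of "w \<circ> p" n'] assms(3) unfolding n
    by (simp add: o_def) (smt (verit) zero_le_power2)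
  then show ?thesis unfolding permuted_path_sum[OF assms(1)] by (rule real_le_rsqrt)
qed

text \<open>The exponential at position i factors over the binary digits of i. On each slice the
  affine part and the digits of the first n variables merge into unimodular weights, which leaves a
  unimodular constant times a permuted Golay sum.\<close>

lemma PMEPR_le_of_affine_slices:
  fixes G :: "nat \<Rightarrow> nat list \<Rightarrow> 'h::len word"
  assumes n: "0 < n" and p: "\<And>v. v \<in> cube k \<Longrightarrow> p v permutes {..<n}"
    and f: "\<And>u v. u \<in> cube n \<Longrightarrow> v \<in> cube k \<Longrightarrow> f (u @ v) =
      2 ^ (LENGTH('h) - 1) * of_nat (path_form n (p v) u) + (\<Sum>i<n. of_nat (u ! i) * G i v) + g v"
  shows "PMEPR \<zeta> (polyphase (psi (n + k) f)) \<le> 2 ^ (k + 1)"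
proof -
  define S where "S \<theta> = (\<Sum>i<2 ^ (n + k). polyphase (psi (n + k) f) $ i *
      exp (2 * of_real pi * \<i> * (of_nat i + of_real \<zeta>) * of_real \<theta>))" for \<theta>
  have S: "cmod (S \<theta>) \<le> 2 ^ k * sqrt (2 ^ (n + 1))" for \<theta>
  proof -
    \<comment> \<open>The factor contributed by binary digit \<open>\<alpha>\<close> of the
      position.\<close>
    define z where "z \<alpha> = cis (2 * pi * \<theta> * 2 ^ \<alpha>)" for \<alpha> :: nat
    define F where "F x = xi_pow (f x) * (\<Prod>\<alpha><n + k. z \<alpha> ^ (x ! \<alpha>))" for x
    \<comment> \<open>The carrier offset \<open>\<zeta>\<close> only multiplies the whole sum by a
      number of modulus 1.\<close>
    define K where "K = cis (2 * pi * \<zeta> * \<theta>)"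
    have z: "(\<Prod>\<alpha><l. z \<alpha> ^ (x ! \<alpha>)) = cis (2 * pi * \<theta> * real (index_of l x))" for l x
      by (induction l) (simp_all add: index_of_def z_def DeMoivre cis_mult algebra_simps)
    have "S \<theta> = (\<Sum>i<2 ^ (n + k). K * F (bits_of (n + k) i))"
      unfolding S_def
    proof (rule sum.cong)
      fix i :: nat assume "i \<in> {..<2 ^ (n + k)}"
      then have i: "i < 2 ^ (n + k)" by simp
      have "exp (2 * of_real pi * \<i> * (of_nat i + of_real \<zeta>) * of_real \<theta>) =
          K * (\<Prod>\<alpha><n + k. z \<alpha> ^ (bits_of (n + k) i ! \<alpha>))"
        unfolding z index_of_bits_of[OF i] K_def cis_mult cis_conv_exp
        by (simp add: algebra_simps exp_add)
      then show "polyphase (psi (n + k) f) $ i *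
          exp (2 * of_real pi * \<i> * (of_nat i + of_real \<zeta>) * of_real \<theta>) = K * F (bits_of (n + k) i)"
        using i by (simp add: F_def polyphase_def psi_def)
    qed simp
    also have "\<dots> = K * (\<Sum>v\<in>cube k. \<Sum>u\<in>cube n. F (u @ v))"
      by (simp only: sum_distrib_left[symmetric] sum_bits_of sum_cube_append)
    finally have "cmod (S \<theta>) = cmod (\<Sum>v\<in>cube k. \<Sum>u\<in>cube n. F (u @ v))"
      by (simp add: norm_mult K_def)
    also have "\<dots> \<le> (\<Sum>v\<in>cube k. sqrt (2 ^ (n + 1)))"
    proof (rule sum_norm_le)
      fix v assume v: "v \<in> cube k"
      define w where "w i = xi_pow (G i v) * z i" for i
      \<comment> \<open>Everything constant on the slice: the constant term of the affine part and
        the digits of the last k variables.\<close>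
      define L where "L = xi_pow (g v) * (\<Prod>\<beta><k. z (n + \<beta>) ^ (v ! \<beta>))"
      have "F (u @ v) = L * ((-1) ^ path_form n (p v) u * (\<Prod>i<n. w i ^ (u ! i)))" if u: "u \<in> cube n" for u
      proof -
        have "xi_pow (f (u @ v)) = (-1) ^ path_form n (p v) u * (\<Prod>i<n. xi_pow (G i v) ^ (u ! i)) * xi_pow (g v)"
          unfolding f[OF u v] xi_pow_add xi_pow_sum
          by (simp add: mult.commute[of "2 ^ _"] xi_pow_of_nat_mult xi_pow_half[simplified])
        moreover have "(\<Prod>\<alpha><n + k. z \<alpha> ^ ((u @ v) ! \<alpha>)) =
            (\<Prod>i<n. z i ^ (u ! i)) * (\<Prod>\<beta><k. z (n + \<beta>) ^ (v ! \<beta>))"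
          using length_cube[OF u] by (induction k) (simp_all add: nth_append)
        ultimately show ?thesis
          by (simp add: F_def L_def w_def power_mult_distrib prod.distrib mult_ac)
      qed
      then have "(\<Sum>u\<in>cube n. F (u @ v)) =
          L * (\<Sum>u\<in>cube n. (-1) ^ path_form n (p v) u * (\<Prod>i<n. w i ^ (u ! i)))"
        by (simp add: sum_distrib_left)
      moreover have "cmod L = 1"
        by (simp add: L_def norm_mult norm_power z_def flip: prod_norm)
      moreover have "cmod (w i) = 1" for i by (simp add: w_def norm_mult z_def)
      ultimately show "cmod (\<Sum>u\<in>cube n. F (u @ v)) \<le> sqrt (2 ^ (n + 1))"
        using cmod_permuted_path_sum_le[OF p[OF v] n, of w] by (simp add: norm_mult)
    qed
    also have "\<dots> = 2 ^ k * sqrt (2 ^ (n + 1))" by (simp add: card_cube)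
    finally show ?thesis .
  qed
  have "(SUP \<theta>\<in>{0..<1}. (cmod (S \<theta>))\<^sup>2) \<le> (2 ^ k * sqrt (2 ^ (n + 1)))\<^sup>2"
    by (rule cSUP_least) (simp, rule power_mono[OF S], simp)
  also have "\<dots> = 2 ^ (n + k) * 2 ^ (k + 1)"
    by (simp add: power_mult_distrib power_add power2_eq_square)
  finally have "(SUP \<theta>\<in>{0..<1}. (cmod (S \<theta>))\<^sup>2) \<le> 2 ^ (n + k) * 2 ^ (k + 1)" .
  then show ?thesis
    unfolding PMEPR_def S_def by (simp add: polyphase_def divide_le_eq mult.commute)
qed

section \<open>The codes\<close>

lemma code_A_iff:
  "w \<in> code_A k r m \<longleftrightarrow> (\<exists>G g. (\<forall>i<m-k. G i \<in> GBF (int r - 1) k) \<and> g \<in> GBF (int r) k \<and>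
     w = psi m (\<lambda>x. (\<Sum>i<m-k. of_nat (x ! i) * G i (drop (m-k) x)) + g (drop (m-k) x)))"
  unfolding code_A_def by blast

lemma code_A_carrier: "code_A k r m \<subseteq> carrier_vec (2 ^ m)"
  by (auto simp: code_A_def)

lemma code_A_diff:
  assumes "a \<in> code_A k r m" "b \<in> code_A k r m"
  shows "a - b \<in> code_A k r m"
proof -
  obtain G g where a: "\<forall>i<m-k. G i \<in> GBF (int r - 1) k" "g \<in> GBF (int r) k"
    "a = psi m (\<lambda>x. (\<Sum>i<m-k. of_nat (x ! i) * G i (drop (m-k) x)) + g (drop (m-k) x))"
    using assms(1) unfolding code_A_iff by blast
  obtain G' g' where b: "\<forall>i<m-k. G' i \<in> GBF (int r - 1) k" "g' \<in> GBF (int r) k"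
    "b = psi m (\<lambda>x. (\<Sum>i<m-k. of_nat (x ! i) * G' i (drop (m-k) x)) + g' (drop (m-k) x))"
    using assms(2) unfolding code_A_iff by blast
  show ?thesis
    unfolding code_A_iff
    by (intro exI[of _ "\<lambda>i x. G i x - G' i x"] exI[of _ "\<lambda>x. g x - g' x"])
      (use a b in \<open>auto simp: GBF_diff psi_diff algebra_simps sum_subtractf intro!: arg_cong[of _ _ "psi m"]\<close>)
qed

lemma zero_in_code_A: "0\<^sub>v (2 ^ m) \<in> code_A k r m"
proof -
  have "0\<^sub>v (2 ^ m) = psi m (\<lambda>x. 0)" by (auto simp: psi_def)
  then show ?thesis unfolding code_A_iff
    by (intro exI[of _ "\<lambda>_ _. 0"] exI[of _ "\<lambda>_. 0"]) (auto intro: GBF_const)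
qed

lemma code_A_subset_ERM:
  assumes "k \<le> m" shows "code_A k r m \<subseteq> ERM (int r) m"
proof
  fix a :: "'h::len word vec" assume "a \<in> code_A k r m"
  then obtain G g where a: "\<forall>i<m-k. G i \<in> GBF (int r - 1) k" "g \<in> GBF (int r) k"
    "a = psi m (\<lambda>x. (\<Sum>i<m-k. of_nat (x ! i) * G i (drop (m-k) x)) + g (drop (m-k) x))"
    unfolding code_A_iff by blast
  have d: "(\<lambda>x. e (drop (m-k) x)) \<in> GBF \<rho> m" if "e \<in> GBF \<rho> k" for \<rho> and e :: "nat list \<Rightarrow> 'h word"
    using GBF_drop[OF that, of "m - k"] assms by simp
  have "(\<lambda>x. of_nat (x ! i) * G i (drop (m-k) x)) \<in> GBF (int r) m" if "i < m - k" for i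
    using GBF_mult[OF GBF_coordinate[of i m] d[of "G i" "int r - 1"]] a(1) that by simp
  then show "a \<in> ERM (int r) m"
    unfolding a(3) psi_in_ERM_iff by (intro GBF_add GBF_sum d a(2)) auto
qed

lemma words_R_eq:
  assumes "k \<le> m"
  shows "words_R k m = {psi m (\<lambda>x. 2 ^ (LENGTH('h) - 1) *
     of_nat (path_form (m-k) (\<pi> (drop (m-k) x)) x) :: 'h::len word) | \<pi>.
     \<forall>d\<in>cube k. \<pi> d permutes {..<m-k}}"
proof -
  have "(\<Sum>d\<in>cube k. (\<Sum>i<m-k-1. of_nat (x ! (\<pi> d i)) * of_nat (x ! (\<pi> d (i + 1)))) *
        (\<Prod>j<k. of_nat (x ! (m-k+j)) ^ (d ! j) * (1 - of_nat (x ! (m-k+j))) ^ (1 - d ! j))) =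
      (of_nat (path_form (m-k) (\<pi> (drop (m-k) x)) x) :: 'h word)"
    if x: "x \<in> cube m" for x and \<pi> :: "nat list \<Rightarrow> nat \<Rightarrow> nat"
  proof -
    let ?y = "drop (m-k) x"
    have y: "?y \<in> cube k" using drop_in_cube[OF x, of "m - k"] assms by simp
    have nth: "x ! (m - k + j) = ?y ! j" for j using length_cube[OF x] by simp
    have "(\<Sum>d\<in>cube k. (\<Sum>i<m-k-1. of_nat (x ! (\<pi> d i)) * of_nat (x ! (\<pi> d (i + 1)))) *
        (\<Prod>j<k. of_nat (x ! (m-k+j)) ^ (d ! j) * (1 - of_nat (x ! (m-k+j))) ^ (1 - d ! j))) =
        (\<Sum>d\<in>cube k. if d = ?y then (of_nat (path_form (m-k) (\<pi> d) x) :: 'h word) else 0)"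
      unfolding nth by (intro sum.cong refl, subst cube_indicator[OF y]) (auto simp: path_form_def)
    also have "\<dots> = of_nat (path_form (m-k) (\<pi> ?y) x)"
      using y by (simp add: finite_cube)
    finally show ?thesis .
  qed
  then have "psi m (\<lambda>x. 2 ^ (LENGTH('h) - 1) *
      (\<Sum>d\<in>cube k. (\<Sum>i<m-k-1. of_nat (x ! (\<pi> d i)) * of_nat (x ! (\<pi> d (i + 1)))) *
        (\<Prod>j<k. of_nat (x ! (m-k+j)) ^ (d ! j) * (1 - of_nat (x ! (m-k+j))) ^ (1 - d ! j)))) =
      psi m (\<lambda>x. 2 ^ (LENGTH('h) - 1) * of_nat (path_form (m-k) (\<pi> (drop (m-k) x)) x) :: 'h word)" for \<pi>
    unfolding psi_eq_iff by simp
  then show ?thesis unfolding words_R_def by presburger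
qed

lemma path_form_append:
  assumes "p permutes {..<n}" "u \<in> cube n"
  shows "path_form n p (u @ v) = path_form n p u"
proof -
  have "p i < n" if "i < n" for i using permutes_in_image[OF assms(1), of i] that by simp
  then show ?thesis
    unfolding path_form_def using length_cube[OF assms(2)]
    by (intro sum.cong refl) (auto simp: nth_append)
qed

lemma PMEPR_coset:
  assumes "k < m" "w \<in> words_R k m" "a \<in> code_A k r m"
  shows "PMEPR \<zeta> (polyphase (w + a :: 'h::len word vec)) \<le> 2 ^ (k + 1)"
proof -
  let ?n = "m - k"
  obtain \<pi> where w: "\<forall>d\<in>cube k. \<pi> d permutes {..<?n}"
    "w = psi m (\<lambda>x. 2 ^ (LENGTH('h) - 1) * of_nat (path_form ?n (\<pi> (drop ?n x)) x))"
    using assms(1,2) by (auto simp: words_R_eq)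
  obtain G g where a: "a = psi m (\<lambda>x. (\<Sum>i<?n. of_nat (x ! i) * G i (drop ?n x)) + g (drop ?n x))"
    using assms(3) unfolding code_A_iff by blast
  define f where "f x = 2 ^ (LENGTH('h) - 1) * of_nat (path_form ?n (\<pi> (drop ?n x)) x) +
     ((\<Sum>i<?n. of_nat (x ! i) * G i (drop ?n x)) + g (drop ?n x))" for x
  have "PMEPR \<zeta> (polyphase (psi (?n + k) f)) \<le> 2 ^ (k + 1)"
  proof (rule PMEPR_le_of_affine_slices[where p = \<pi> and G = G and g = g])
    fix u v assume u: "u \<in> cube ?n" and v: "v \<in> cube k"
    have "(\<Sum>i<?n. of_nat ((u @ v) ! i) * G i v) = (\<Sum>i<?n. of_nat (u ! i) * G i v)"
      using length_cube[OF u] by (intro sum.cong) (auto simp: nth_append)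
    then show "f (u @ v) = 2 ^ (LENGTH('h) - 1) * of_nat (path_form ?n (\<pi> v) u) +
        (\<Sum>i<?n. of_nat (u ! i) * G i v) + g v"
      using length_cube[OF u] path_form_append[OF _ u] w(1) v by (simp add: f_def)
  qed (use assms(1) w(1) in auto)
  moreover have "w + a = psi (?n + k) f"
    unfolding w(2) a psi_add f_def using assms(1) by simp
  ultimately show ?thesis by simp
qed

section \<open>Hamiltonian paths\<close>

definition path_edges :: "nat \<Rightarrow> (nat \<Rightarrow> nat) \<Rightarrow> nat set set" where
  "path_edges n p = (\<lambda>i. {p i, p (Suc i)}) ` {..<n-1}"

lemma path_edgesI: "Suc i < n \<Longrightarrow> {p i, p (Suc i)} \<in> path_edges n p"
  by (auto simp: path_edges_def)

lemma path_edgesE: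
  assumes "e \<in> path_edges n p"
  obtains i where "Suc i < n" "e = {p i, p (Suc i)}"
proof -
  from assms obtain i where "i < n - 1" "e = {p i, p (Suc i)}" by (auto simp: path_edges_def)
  then show thesis using that[of i] by simp
qed

text \<open>From a common initial stretch both paths must continue alike: the next edge of
  \<open>p\<close> at the current vertex is an edge of \<open>q\<close>, and the only other
  candidate leads back.\<close>

lemma path_edges_same_start:
  assumes p: "p permutes {..<n}" and q: "q permutes {..<n}"
    and E: "path_edges n p = path_edges n q" and start: "p 0 = q 0"
  shows "p = q"
proof
  have inj: "p i = p j \<longleftrightarrow> i = j" "q i = q j \<longleftrightarrow> i = j" for i j
    using permutes_inj[OF p] permutes_inj[OF q] by (simp_all add: inj_eq)
  have "p i = q i" if "i < n" for i
    using that
  proof (induction i rule: less_induct)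
    case (less i)
    show ?case
    proof (cases i)
      case 0
      then show ?thesis using start by simp
    next
      case (Suc j)
      then have pj: "p j = q j" using less by simp
      obtain l where l: "Suc l < n" "{p j, p (Suc j)} = {q l, q (Suc l)}"
        using path_edgesI[of j n p] less.prems Suc E by (auto elim: path_edgesE)
      then have "j = l \<or> j = Suc l" using pj inj by (auto simp: doubleton_eq_iff)
      then show ?thesis
      proof
        assume "j = l"
        then show ?thesis using l pj inj Suc by (auto simp: doubleton_eq_iff)
      next
        \<comment> \<open>The backward edge would revisit \<open>q l\<close>, which is
          \<open>p l\<close> by the induction hypothesis, against injectivity.\<close>
        assume j: "j = Suc l"
        then have "p (Suc j) = q l" using l pj inj by (auto simp: doubleton_eq_iff)
        moreover have "p l = q l" using less j Suc by simp
        ultimately have "p (Suc j) = p l" by simp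
        then show ?thesis using inj j by simp
      qed
    qed
  qed
  then show "p i = q i" for i
    using permutes_not_in[OF p, of i] permutes_not_in[OF q, of i] by (cases "i < n") auto
qed

definition flip_path :: "nat \<Rightarrow> nat \<Rightarrow> nat" where
  "flip_path n i = (if i < n then n - 1 - i else i)"

lemma flip_path_permutes: "flip_path n permutes {..<n}"
proof (rule bij_imp_permutes)
  show "bij_betw (flip_path n) {..<n} {..<n}"
    by (rule bij_betw_byWitness[where f' = "flip_path n"]) (auto simp: flip_path_def)
qed (simp add: flip_path_def)

lemma path_edges_flip_path: "path_edges n (q \<circ> flip_path n) = path_edges n q"
proof -
  have *: "path_edges n (q \<circ> flip_path n) \<subseteq> path_edges n q" for q
  proof
    fix e assume "e \<in> path_edges n (q \<circ> flip_path n)"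
    then obtain i where i: "Suc i < n" "e = {q (n - 1 - i), q (n - 1 - Suc i)}"
      by (auto elim!: path_edgesE simp: flip_path_def)
    moreover have "n - 1 - i = Suc (n - 1 - Suc i)" using i by simp
    ultimately show "e \<in> path_edges n q"
      using path_edgesI[of "n - 1 - Suc i" n q] by (simp add: insert_commute)
  qed
  have "(q \<circ> flip_path n) \<circ> flip_path n = q"
    by (auto simp: flip_path_def fun_eq_iff)
  with *[of q] *[of "q \<circ> flip_path n"] show ?thesis by simp
qed

text \<open>The start of \<open>p\<close> has only one edge, while an inner vertex of
  \<open>q\<close> has two. Hence it is an end of \<open>q\<close>, and after a possible reversal
  both paths start at the same vertex.\<close>

lemma path_edges_eq:
  assumes p: "p permutes {..<n}" and q: "q permutes {..<n}" and n: "0 < n"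
    and E: "path_edges n p = path_edges n q"
  shows "p = q \<or> p = q \<circ> flip_path n"
proof -
  have inj: "p i = p j \<longleftrightarrow> i = j" "q i = q j \<longleftrightarrow> i = j" for i j
    using permutes_inj[OF p] permutes_inj[OF q] by (simp_all add: inj_eq)
  have "p 0 \<in> q ` {..<n}" using n permutes_in_image[OF p, of 0] permutes_image[OF q] by simp
  then obtain i where i: "i < n" "p 0 = q i" by auto
  \<comment> \<open>Any edge of \<open>q\<close> at the start of \<open>p\<close> is an edge of
    \<open>p\<close>, hence the first one.\<close>
  have first: "e = {p 0, p (Suc 0)}" if "e \<in> path_edges n q" "p 0 \<in> e" for e
    using that inj unfolding E[symmetric] by (auto elim!: path_edgesE)
  consider "i = 0" | "Suc i = n" | j where "i = Suc j" "Suc i < n"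
    using i Suc_lessI by (cases i) blast+
  then show ?thesis
  proof cases
    case 1
    then show ?thesis using path_edges_same_start[OF p q E] i by simp
  next
    case 2
    have "q \<circ> flip_path n permutes {..<n}"
      by (rule permutes_compose[OF flip_path_permutes q])
    moreover have "p 0 = (q \<circ> flip_path n) 0" using i 2 n by (auto simp: flip_path_def)
    ultimately show ?thesis
      using path_edges_same_start[OF p, of "q \<circ> flip_path n"] E by (simp add: path_edges_flip_path)
  next
    case 3
    have "{q j, q i} = {p 0, p (Suc 0)}" "{q i, q (Suc i)} = {p 0, p (Suc 0)}"
      using first[OF path_edgesI[of j n q]] first[OF path_edgesI[of i n q]] 3 i by auto
    then have "{q j, q i} = {q i, q (Suc i)}" by simp
    then have "q j = q (Suc i)" by (auto simp: doubleton_eq_iff)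
    then show ?thesis using inj 3 by simp
  qed
qed

text \<open>T picks one permutation for each edge set. A permutation is its representative or the
  reversal of it, so T and its reversals together cover all n! permutations.\<close>

lemma ex_many_path_edges:
  assumes "0 < n"
  obtains T where "\<And>p. p \<in> T \<Longrightarrow> p permutes {..<n}" "inj_on (path_edges n) T" "fact n \<le> 2 * card T"
proof -
  define P where "P = {p. p permutes {..<n}}"
  have P: "finite P" "card P = fact n"
    unfolding P_def by (auto simp: finite_permutations card_permutations)
  have "path_edges n ` P \<subseteq> path_edges n ` P" by simp
  then obtain T where T: "T \<subseteq> P" "inj_on (path_edges n) T" "path_edges n ` P = path_edges n ` T"
    unfolding subset_image_inj by blast
  have "P \<subseteq> T \<union> (\<lambda>q. q \<circ> flip_path n) ` T"
  proof
    fix p assume p: "p \<in> P"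
    then obtain q where "q \<in> T" "path_edges n p = path_edges n q" using T(3) by blast
    then show "p \<in> T \<union> (\<lambda>q. q \<circ> flip_path n) ` T"
      using path_edges_eq[of p n q] p T(1) assms unfolding P_def by blast
  qed
  then have "card P \<le> card (T \<union> (\<lambda>q. q \<circ> flip_path n) ` T)"
    using finite_subset[OF T(1) P(1)] by (intro card_mono) auto
  also have "\<dots> \<le> card T + card ((\<lambda>q. q \<circ> flip_path n) ` T)" by (rule card_Un_le)
  also have "\<dots> \<le> 2 * card T" using card_image_le[OF finite_subset[OF T(1) P(1)]] by simp
  finally show thesis using that T(1,2) P(2) unfolding P_def by auto
qed

section \<open>Recovering a path from its form modulo affine functions\<close>

definition indicator_point :: "nat \<Rightarrow> nat set \<Rightarrow> nat list" where
  "indicator_point n S = map (\<lambda>i. if i \<in> S then 1 else 0) [0..<n]"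

lemma indicator_point_in_cube: "indicator_point n S \<in> cube n"
  by (auto simp: indicator_point_def cube_def)

lemma nth_indicator_point: "i < n \<Longrightarrow> indicator_point n S ! i = (if i \<in> S then 1 else 0)"
  by (simp add: indicator_point_def)

lemma path_form_indicator_point:
  assumes p: "p permutes {..<n}"
  shows "path_form n p (indicator_point n S) = card {i. Suc i < n \<and> {p i, p (Suc i)} \<subseteq> S}"
proof -
  have "p i < n" if "i < n" for i using permutes_in_image[OF p, of i] that by simp
  then have "path_form n p (indicator_point n S) =
      (\<Sum>i<n-1. if {p i, p (Suc i)} \<subseteq> S then 1 else 0)"
    unfolding path_form_def by (intro sum.cong) (auto simp: nth_indicator_point)
  also have "\<dots> = card {i \<in> {..<n-1}. {p i, p (Suc i)} \<subseteq> S}"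
    by (subst sum.inter_filter[symmetric]) auto
  also have "{i \<in> {..<n-1}. {p i, p (Suc i)} \<subseteq> S} = {i. Suc i < n \<and> {p i, p (Suc i)} \<subseteq> S}"
    by auto
  finally show ?thesis .
qed

lemma path_form_indicator_singleton:
  assumes p: "p permutes {..<n}"
  shows "path_form n p (indicator_point n {a}) = 0" "path_form n p (indicator_point n {}) = 0"
proof -
  have "\<not> {p i, p (Suc i)} \<subseteq> {a}" for i
    using inj_eq[OF permutes_inj[OF p], of i "Suc i"] by auto
  then have "{i. Suc i < n \<and> {p i, p (Suc i)} \<subseteq> {a}} = {}" by blast
  then show "path_form n p (indicator_point n {a}) = 0"
    by (simp only: path_form_indicator_point[OF p] card.empty)
qed (simp add: path_form_indicator_point[OF p])

text \<open>A path edge has two distinct ends, so inside \<open>{a, b}\<close> it must equal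
  \<open>{a, b}\<close>; no edge occurs at two positions of the path.\<close>

lemma path_form_indicator_pair:
  assumes p: "p permutes {..<n}"
  shows "path_form n p (indicator_point n {a, b}) = (if {a, b} \<in> path_edges n p then 1 else 0)"
proof -
  have inj: "p i = p j \<longleftrightarrow> i = j" for i j
    using permutes_inj[OF p] by (simp add: inj_eq)
  have sub: "{p i, p (Suc i)} \<subseteq> {a, b} \<longleftrightarrow> {p i, p (Suc i)} = {a, b}" for i
    using inj[of i "Suc i"] by auto
  show ?thesis
  proof (cases "{a, b} \<in> path_edges n p")
    case True
    then obtain i where i: "Suc i < n" "{a, b} = {p i, p (Suc i)}" by (rule path_edgesE)
    have "{j. Suc j < n \<and> {p j, p (Suc j)} \<subseteq> {a, b}} = {i}"
      unfolding sub i(2) using i(1) by (auto simp: doubleton_eq_iff inj)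
    then show ?thesis unfolding path_form_indicator_point[OF p] using True by simp
  next
    case False
    then have "{j. Suc j < n \<and> {p j, p (Suc j)} \<subseteq> {a, b}} = {}"
      unfolding sub using path_edgesI[of _ n p] by (metis (mono_tags, lifting) empty_Collect_eq)
    then show ?thesis using False by (simp only: path_form_indicator_point[OF p] card.empty if_False)
  qed
qed

text \<open>The mixed second difference at \<open>a \<noteq> b\<close> kills affine functions and detects the edge
  \<open>{a, b}\<close> in a path form.\<close>

lemma path_edges_eq_if_affine_diff:
  fixes c :: "nat \<Rightarrow> 'h::len word"
  assumes p: "p permutes {..<n}" and q: "q permutes {..<n}"
    and aff: "\<And>u. u \<in> cube n \<Longrightarrow> 2 ^ (LENGTH('h) - 1) * of_nat (path_form n p u) -
      2 ^ (LENGTH('h) - 1) * of_nat (path_form n q u) = (\<Sum>i<n. of_nat (u ! i) * c i) + c0"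
  shows "path_edges n p = path_edges n q"
proof -
  \<comment> \<open>Only the parity of a form is visible after multiplication by 2^(h-1). The points
    used below have at most two ones, where the form is 0 or 1, so parity suffices.\<close>
  have half: "(2 :: 'h word) ^ (LENGTH('h) - 1) \<noteq> 0" by simp
  have "e \<in> path_edges n p \<longleftrightarrow> e \<in> path_edges n q" if e: "e \<in> path_edges n p \<union> path_edges n q" for e
  proof -
    obtain r i where r: "r permutes {..<n}" "Suc i < n" "e = {r i, r (Suc i)}"
      using e p q by (auto elim!: path_edgesE)
    define a b where "a = r i" and "b = r (Suc i)"
    have ab: "a < n" "b < n" "a \<noteq> b" "e = {a, b}"
      using r permutes_in_image[OF r(1), of i] permutes_in_image[OF r(1), of "Suc i"]
        inj_eq[OF permutes_inj[OF r(1)], of i "Suc i"]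
      by (simp_all add: a_def b_def)
    let ?l = "\<lambda>S. (\<Sum>i<n. of_nat (indicator_point n S ! i) * c i) + c0"
    have s: "(\<Sum>i<n. of_nat (indicator_point n S ! i) * c i) = (\<Sum>i\<in>S. c i)" if "S \<subseteq> {..<n}" for S
    proof -
      have "(\<Sum>i<n. of_nat (indicator_point n S ! i) * c i) = (\<Sum>i<n. if i \<in> S then c i else 0)"
        by (intro sum.cong) (auto simp: nth_indicator_point)
      also have "\<dots> = (\<Sum>i\<in>S. c i)" using that by (simp add: sum.If_cases Int_absorb1)
      finally show ?thesis .
    qed
    have "?l {a, b} = ?l {a} + ?l {b} - ?l {}"
      using ab s[of "{a, b}"] s[of "{a}"] s[of "{b}"] s[of "{}"] by (simp add: algebra_simps)
    then have "2 ^ (LENGTH('h) - 1) * of_nat (path_form n p (indicator_point n {a, b})) -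
        2 ^ (LENGTH('h) - 1) * of_nat (path_form n q (indicator_point n {a, b})) = (0 :: 'h word)"
      unfolding aff[OF indicator_point_in_cube, symmetric]
      by (simp add: path_form_indicator_singleton[OF p] path_form_indicator_singleton[OF q])
    then show ?thesis
      using half unfolding path_form_indicator_pair[OF p] path_form_indicator_pair[OF q] ab(4)
      by (auto split: if_splits)
  qed
  then show ?thesis by blast
qed

section \<open>Cosets\<close>

text \<open>Vectors of all dimensions share one type, so the coset argument is carried out inside
  \<open>carrier_vec n\<close>, with 0 and closure under subtraction as the subgroup axioms.\<close>

lemma coset_eq_of_mem:
  fixes A :: "'a::ab_group_add vec set"
  assumes A: "A \<subseteq> carrier_vec n" "0\<^sub>v n \<in> A" "\<And>a b. a \<in> A \<Longrightarrow> b \<in> A \<Longrightarrow> a - b \<in> A"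
    and a: "a \<in> carrier_vec n" and x: "x \<in> {a + c | c. c \<in> A}"
  shows "{a + c | c. c \<in> A} = {x + c | c. c \<in> A}"
proof -
  obtain d where d: "d \<in> A" "x = a + d" using x by blast
  have add: "b + c \<in> A" if "b \<in> A" "c \<in> A" for b c
  proof -
    have "b + c = b - (0\<^sub>v n - c)" using that A(1) by (intro eq_vecI) auto
    then show ?thesis using A that by simp
  qed
  have "a + c = x + (c - d)" "x + c = a + (d + c)" if "c \<in> A" for c
  proof -
    have "c \<in> carrier_vec n" "d \<in> carrier_vec n" using that d A(1) by auto
    then show "a + c = x + (c - d)" "x + c = a + (d + c)"
      using d(2) a by (auto intro!: eq_vecI)
  qed
  then show ?thesis using d add A(3) by blast
qed

lemma coset_diff_mem:
  fixes A :: "'a::ab_group_add vec set"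
  assumes "A \<subseteq> carrier_vec n" "0\<^sub>v n \<in> A" "a \<in> carrier_vec n" "b \<in> carrier_vec n"
    and "{a + c | c. c \<in> A} = {b + c | c. c \<in> A}"
  shows "a - b \<in> A"
proof -
  have "a + 0\<^sub>v n \<in> {b + c | c. c \<in> A}" using assms(2,5) by blast
  then obtain c where c: "c \<in> A" "a + 0\<^sub>v n = b + c" by blast
  then have "a = b + c" using assms(3) by simp
  then have "a - b = c" using assms(1,4) c(1) by (intro eq_vecI) auto
  then show ?thesis using c(1) by simp
qed

lemma card_coset:
  fixes A :: "'a::ab_group_add vec set"
  assumes "A \<subseteq> carrier_vec n" "a \<in> carrier_vec n"
  shows "card {a + c | c. c \<in> A} = card A"
proof -
  have "inj_on (\<lambda>c. a + c) A"
  proof (rule inj_onI)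
    fix c d assume cd: "c \<in> A" "d \<in> A" "a + c = a + d"
    have "c = (a + c) - a" "d = (a + d) - a"
      using cd(1,2) assms by (auto intro!: eq_vecI)
    with cd(3) show "c = d" by simp
  qed
  then show ?thesis by (simp add: card_image image_def[symmetric] setcompr_eq_image)
qed

lemma card_Union_cosets:
  fixes A :: "'a::ab_group_add vec set"
  assumes A: "A \<subseteq> carrier_vec n" "0\<^sub>v n \<in> A" "\<And>a b. a \<in> A \<Longrightarrow> b \<in> A \<Longrightarrow> a - b \<in> A"
    and "finite A" and K: "\<K> \<subseteq> cosets_of n A"
  shows "card (\<Union>\<K>) = card A * card \<K>"
proof -
  have rep: "\<exists>a\<in>carrier_vec n. K = {a + c | c. c \<in> A}" if "K \<in> \<K>" for K
    using that K unfolding cosets_of_def by blast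
  have "card (\<Union>\<K>) = sum card \<K>"
  proof (rule card_Union_disjoint)
    show "pairwise disjnt \<K>"
    proof (rule pairwiseI)
      fix K L assume KL: "K \<in> \<K>" "L \<in> \<K>" "K \<noteq> L"
      then obtain a b where ab: "a \<in> carrier_vec n" "K = {a + c | c. c \<in> A}"
        "b \<in> carrier_vec n" "L = {b + c | c. c \<in> A}" using rep by meson
      have False if "x \<in> K" "x \<in> L" for x
        using KL(3) coset_eq_of_mem[OF A ab(1), of x] coset_eq_of_mem[OF A ab(3), of x] that
        unfolding ab(2,4) by blast
      then show "disjnt K L" by (auto simp: disjnt_def)
    qed
    show "finite K" if "K \<in> \<K>" for K using rep[OF that] \<open>finite A\<close> by auto
  qed
  also have "\<dots> = (\<Sum>K\<in>\<K>. card A)"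
    by (intro sum.cong refl) (use rep card_coset[OF A(1)] in blast)
  finally show ?thesis by simp
qed

text \<open>Finiteness of the codes gives meaning to their cardinalities and to the
  \<open>Min\<close> in the minimum distances.\<close>

lemma finite_carrier_vec_word: "finite (carrier_vec n :: 'h::len word vec set)"
proof -
  have "carrier_vec n \<subseteq> vec_of_list ` {xs :: 'h word list. set xs \<subseteq> UNIV \<and> length xs = n}"
  proof
    fix v :: "'h word vec" assume "v \<in> carrier_vec n"
    then show "v \<in> vec_of_list ` {xs. set xs \<subseteq> UNIV \<and> length xs = n}"
      by (intro image_eqI[of _ _ "list_of_vec v"]) (auto simp: vec_list)
  qed
  then show ?thesis by (rule finite_subset) (intro finite_imageI finite_lists_length_eq finite)
qed

section \<open>Cosets with a word of small effective degree\<close>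

text \<open>The path is looked up by the first e of the last k coordinates alone, so the indicators
  needed to write the word as a polynomial have degree e and not k.\<close>

definition path_word :: "nat \<Rightarrow> nat \<Rightarrow> nat \<Rightarrow> (nat list \<Rightarrow> nat \<Rightarrow> nat) \<Rightarrow> 'h::len word vec" where
  "path_word k m e \<phi> = psi m (\<lambda>x. 2 ^ (LENGTH('h) - 1) *
     of_nat (path_form (m-k) (\<phi> (take e (drop (m-k) x))) x))"

lemma path_word_in_words_R:
  assumes "k \<le> m" "e \<le> k" "\<And>d. d \<in> cube e \<Longrightarrow> \<phi> d permutes {..<m-k}"
  shows "path_word k m e \<phi> \<in> words_R k m"
  unfolding words_R_eq[OF assms(1)] path_word_def
  by (intro CollectI exI[of _ "\<lambda>d. \<phi> (take e d)"]) (use assms take_in_cube in blast)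

text \<open>Each summand is 2^(h-1) times a quadratic form times an indicator in e variables, of
  bound 2 - (h-1) + e; the hypothesis says exactly that this is at most r.\<close>

lemma path_word_degree:
  assumes km: "k \<le> m" "e \<le> k" and \<phi>: "\<And>d. d \<in> cube e \<Longrightarrow> \<phi> d permutes {..<m-k}"
    and r: "e + 3 \<le> r + LENGTH('h)"
  shows "word_effective_degree m (path_word k m e \<phi> :: 'h::len word vec) \<le> ereal (real r)"
proof -
  let ?n = "m - k"
  define Q where "Q \<delta> x = (2 ^ (LENGTH('h) - 1) * (\<Sum>i<?n-1. of_nat (x ! \<phi> \<delta> i) * of_nat (x ! \<phi> \<delta> (i + 1))) :: 'h word)" for \<delta> x
  define I where "I \<delta> x = (\<Prod>j<e. of_nat (x ! (?n + j)) ^ (\<delta> ! j) * (1 - of_nat (x ! (?n + j))) ^ (1 - \<delta> ! j) :: 'h word)" for \<delta> x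
  have coord: "(\<lambda>x. of_nat (x ! i) :: 'h word) \<in> GBF 1 m" if "i < m" for i
    by (rule GBF_coordinate[OF that])
  have Q: "Q \<delta> \<in> GBF (2 - int (LENGTH('h) - 1)) m" if "\<delta> \<in> cube e" for \<delta>
  proof -
    have lt: "\<phi> \<delta> i < m" if "i < ?n" for i
      using permutes_in_image[OF \<phi>[OF \<open>\<delta> \<in> cube e\<close>], of i] that by simp
    have "(\<lambda>x. of_nat (x ! \<phi> \<delta> i) * of_nat (x ! \<phi> \<delta> (i + 1)) :: 'h word) \<in> GBF 2 m" if "i < ?n - 1" for i
      using GBF_mult[OF coord coord, OF lt lt, of i "i + 1"] that by simp
    then have "(\<lambda>x. (\<Sum>i<?n-1. of_nat (x ! \<phi> \<delta> i) * of_nat (x ! \<phi> \<delta> (i + 1))) :: 'h word) \<in> GBF 2 m"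
      by (intro GBF_sum) simp
    moreover have "(\<lambda>x. 2 ^ (LENGTH('h) - 1) :: 'h word) \<in> GBF (- int (LENGTH('h) - 1)) m"
      by (intro GBF_const) simp
    ultimately show ?thesis unfolding Q_def using GBF_mult by fastforce
  qed
  have I: "I \<delta> \<in> GBF (int e) m" if \<delta>: "\<delta> \<in> cube e" for \<delta>
  proof -
    have "(\<lambda>x. of_nat (x ! (?n + j)) ^ (\<delta> ! j) * (1 - of_nat (x ! (?n + j))) ^ (1 - \<delta> ! j) :: 'h word)
        \<in> GBF 1 m" if j: "j < e" for j
    proof -
      have c: "(\<lambda>x. of_nat (x ! (?n + j)) :: 'h word) \<in> GBF 1 m" using j km by (intro coord) simp
      \<comment> \<open>As \<open>\<delta> ! j\<close> is 0 or 1, the factor is either the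
        coordinate or 1 minus it.\<close>
      have "(\<lambda>x. 1 :: 'h word) \<in> GBF 1 m" by (intro GBF_const) simp
      from GBF_diff[OF this c] c show ?thesis using nth_cube[OF \<delta> j] by auto
    qed
    then have "(\<lambda>x. \<Prod>j<e. of_nat (x ! (?n + j)) ^ (\<delta> ! j) * (1 - of_nat (x ! (?n + j))) ^ (1 - \<delta> ! j) :: 'h word)
        \<in> GBF (int (card {..<e})) m"
      by (intro GBF_prod) (simp_all only: finite_lessThan lessThan_iff)
    then show ?thesis unfolding I_def by simp
  qed
  have "(\<lambda>x. \<Sum>\<delta>\<in>cube e. Q \<delta> x * I \<delta> x) \<in> GBF (2 - int (LENGTH('h) - 1) + int e) m"
    by (intro GBF_sum GBF_mult Q I)
  then have "(\<lambda>x. \<Sum>\<delta>\<in>cube e. Q \<delta> x * I \<delta> x) \<in> GBF (int r) m"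
    by (rule GBF_mono) (use r in linarith)
  moreover have "(\<Sum>\<delta>\<in>cube e. Q \<delta> x * I \<delta> x) =
      2 ^ (LENGTH('h) - 1) * of_nat (path_form ?n (\<phi> (take e (drop ?n x))) x)" if x: "x \<in> cube m" for x
  proof -
    let ?y = "take e (drop ?n x)"
    have y: "?y \<in> cube e"
      using take_in_cube[OF drop_in_cube[OF x, of ?n], of e] km by simp
    have "x ! (?n + j) = ?y ! j" if "j < e" for j using that length_cube[OF x] km by simp
    then have "I \<delta> x = (if \<delta> = ?y then 1 else 0)" if "\<delta> \<in> cube e" for \<delta>
      unfolding cube_indicator[OF y that, symmetric] I_def by (intro prod.cong) auto
    then have "(\<Sum>\<delta>\<in>cube e. Q \<delta> x * I \<delta> x) = (\<Sum>\<delta>\<in>cube e. if \<delta> = ?y then Q \<delta> x else 0)"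
      by (intro sum.cong) auto
    also have "\<dots> = Q ?y x" using y by (simp add: finite_cube)
    finally show ?thesis by (simp add: Q_def path_form_def)
  qed
  ultimately show ?thesis
    unfolding path_word_def word_effective_degree_psi_le_iff using GBF_cong by (metis (no_types, lifting))
qed

text \<open>Fixing the last k variables turns membership in the code into an affine difference of
  two path forms, which determines the edges.\<close>

lemma path_word_diff_mem_code_A:
  assumes km: "k < m" "e \<le> k"
    and \<phi>: "\<And>d. d \<in> cube e \<Longrightarrow> \<phi> d permutes {..<m-k}" "\<And>d. d \<in> cube e \<Longrightarrow> \<phi>' d permutes {..<m-k}"
    and A: "(path_word k m e \<phi> - path_word k m e \<phi>' :: 'h::len word vec) \<in> code_A k r m"
    and d: "d \<in> cube e"
  shows "path_edges (m-k) (\<phi> d) = path_edges (m-k) (\<phi>' d)"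
proof -
  let ?n = "m - k"
  obtain G g where G: "psi m (\<lambda>x. 2 ^ (LENGTH('h) - 1) * of_nat (path_form ?n (\<phi> (take e (drop ?n x))) x) -
      2 ^ (LENGTH('h) - 1) * of_nat (path_form ?n (\<phi>' (take e (drop ?n x))) x)) =
      psi m (\<lambda>x. (\<Sum>i<?n. of_nat (x ! i) * G i (drop ?n x)) + g (drop ?n x) :: 'h word)"
    using A unfolding path_word_def psi_diff code_A_iff by blast
  \<comment> \<open>Zeros extend \<open>d\<close> to a full slice; the looked-up path depends on
    \<open>d\<close> only.\<close>
  define v where "v = d @ replicate (k - e) (0::nat)"
  have v: "v \<in> cube k" "take e v = d"
    using d km by (auto simp: v_def cube_def)
  show ?thesis
  proof (rule path_edges_eq_if_affine_diff[where c = "\<lambda>i. G i v" and ?c0.0 = "g v"])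
    fix u assume u: "u \<in> cube ?n"
    have "u @ v \<in> cube m" using append_in_cube[OF u v(1)] km by simp
    moreover have "(\<Sum>i<?n. of_nat ((u @ v) ! i) * G i v) = (\<Sum>i<?n. of_nat (u ! i) * G i v)"
      using length_cube[OF u] by (intro sum.cong) (auto simp: nth_append)
    ultimately show "2 ^ (LENGTH('h) - 1) * of_nat (path_form ?n (\<phi> d) u) -
      2 ^ (LENGTH('h) - 1) * of_nat (path_form ?n (\<phi>' d) u) = (\<Sum>i<?n. of_nat (u ! i) * G i v) + g v"
      using G[unfolded psi_eq_iff, rule_format, of "u @ v"] length_cube[OF u] v(2)
        path_form_append[OF \<phi>(1)[OF d] u] path_form_append[OF \<phi>(2)[OF d] u] by simp
  qed (use \<phi> d in auto)
qed

text \<open>One representative path is chosen independently for each of the 2^e points of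
  \<open>cube e\<close>; every choice gives its own coset, so there are |T|^(2^e) of them.\<close>

lemma many_good_cosets:
  fixes A :: "'h::len word vec set"
  assumes km: "k < m" "e \<le> k" and r: "e + 3 \<le> r + LENGTH('h)" and A: "A = code_A k r' m"
    and N: "real N \<le> (fact (m - k) / 2) ^ (2 ^ e)"
  obtains \<K> where "card \<K> = N" "\<K> \<subseteq> {K \<in> cosets_of (2 ^ m) A.
    \<exists>w \<in> K \<inter> words_R k m. word_effective_degree m w \<le> ereal (real r)}"
proof -
  let ?n = "m - k"
  obtain T where T: "\<And>p. p \<in> T \<Longrightarrow> p permutes {..<?n}" "inj_on (path_edges ?n) T" "fact ?n \<le> 2 * card T"
    using ex_many_path_edges[of ?n] km by auto
  \<comment> \<open>Extensional functions: agreement on \<open>cube e\<close> is equality, so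
    choices can be counted and compared pointwise.\<close>
  define \<Phi> where "\<Phi> = PiE (cube e) (\<lambda>_. T)"
  define K where "K \<phi> = {path_word k m e \<phi> + c | c. c \<in> A}" for \<phi>
  have sub: "A \<subseteq> carrier_vec (2 ^ m)" "0\<^sub>v (2 ^ m) \<in> A"
    unfolding A by (auto simp: zero_in_code_A code_A_carrier[THEN subsetD])
  have pw: "(path_word k m e \<phi> :: 'h word vec) \<in> carrier_vec (2 ^ m)" for \<phi>
    by (simp add: path_word_def)
  have perm: "\<phi> d permutes {..<?n}" if "\<phi> \<in> \<Phi>" "d \<in> cube e" for \<phi> d
    using that T(1) by (auto simp: \<Phi>_def PiE_iff)
  have "inj_on K \<Phi>"
  proof (rule inj_onI)
    fix \<phi> \<phi>' assume \<phi>: "\<phi> \<in> \<Phi>" "\<phi>' \<in> \<Phi>" and eq: "K \<phi> = K \<phi>'"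
    have "path_word k m e \<phi> - path_word k m e \<phi>' \<in> A"
      using coset_diff_mem[OF sub pw pw] eq unfolding K_def by blast
    then have edges: "path_edges ?n (\<phi> d) = path_edges ?n (\<phi>' d)" if "d \<in> cube e" for d
      using path_word_diff_mem_code_A[OF km, of \<phi> \<phi>' r' d] perm \<phi> that unfolding A by blast
    have "\<phi> d = \<phi>' d" if "d \<in> cube e" for d
      using inj_on_eq_iff[OF T(2), of "\<phi> d" "\<phi>' d"] edges[OF that] \<phi> that by (simp add: \<Phi>_def PiE_iff)
    then show "\<phi> = \<phi>'" using \<phi> unfolding \<Phi>_def by (intro PiE_ext) auto
  qed
  moreover have "N \<le> card \<Phi>"
  proof -
    have "fact ?n / 2 \<le> real (card T)"
      using T(3) by (metis divide_le_eq_numeral1(1) mult.commute of_nat_fact of_nat_le_iff of_nat_mult of_nat_numeral)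
    then have "(fact ?n / 2) ^ (2 ^ e) \<le> real (card T) ^ (2 ^ e)" by (intro power_mono) auto
    also have "\<dots> = real (card \<Phi>)"
      by (simp add: \<Phi>_def card_PiE finite_cube card_cube)
    finally show ?thesis using N by linarith
  qed
  ultimately have "N \<le> card (K ` \<Phi>)" by (simp add: card_image)
  then obtain \<K> where \<K>: "\<K> \<subseteq> K ` \<Phi>" "card \<K> = N" by (meson obtain_subset_with_card_n)
  moreover have "K \<phi> \<in> {K \<in> cosets_of (2 ^ m) A.
      \<exists>w \<in> K \<inter> words_R k m. word_effective_degree m w \<le> ereal (real r)}" if "\<phi> \<in> \<Phi>" for \<phi>
  proof -
    have "K \<phi> \<in> cosets_of (2 ^ m) A" unfolding K_def cosets_of_def using pw by blast
    moreover have "path_word k m e \<phi> + 0\<^sub>v (2 ^ m) \<in> K \<phi>" unfolding K_def using sub(2) by blast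
    then have "path_word k m e \<phi> \<in> K \<phi>" using pw by simp
    ultimately show ?thesis
      using path_word_in_words_R[of k m e \<phi>] path_word_degree[of k m e \<phi> r] perm[OF that] km r by auto
  qed
  ultimately show thesis using that by blast
qed

section \<open>Minimum distances\<close>

lemma sum_cube_prod: "(\<Sum>x\<in>cube m. \<Prod>\<alpha><m. g \<alpha> (x ! \<alpha>)) = (\<Prod>\<alpha><m. g \<alpha> 0 + g \<alpha> 1 :: nat)"
proof (induction m arbitrary: g)
  case (Suc m)
  have "(\<Sum>x\<in>cube (Suc m). \<Prod>\<alpha><Suc m. g \<alpha> (x ! \<alpha>)) =
      (\<Sum>x\<in>cube m. g 0 0 * (\<Prod>\<alpha><m. g (Suc \<alpha>) (x ! \<alpha>))) + (\<Sum>x\<in>cube m. g 0 1 * (\<Prod>\<alpha><m. g (Suc \<alpha>) (x ! \<alpha>)))"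
    unfolding cube_Suc
    by (subst sum.union_disjoint)
      (auto simp: finite_cube sum.reindex prod.lessThan_Suc_shift simp del: prod.lessThan_Suc)
  also have "\<dots> = (\<Prod>\<alpha><Suc m. g \<alpha> 0 + g \<alpha> 1)"
    unfolding sum_distrib_left[symmetric] Suc.IH[of "\<lambda>\<alpha>. g (Suc \<alpha>)"] prod.lessThan_Suc_shift
    by (simp add: algebra_simps)
  finally show ?case .
qed (simp add: cube_0)

lemma sum_cube_monomial:
  assumes "S \<subseteq> {..<m}"
  shows "(\<Sum>x\<in>cube m. \<Prod>i\<in>S. x ! i) = 2 ^ (m - card S)"
proof -
  let ?g = "\<lambda>\<alpha> b :: nat. if \<alpha> \<in> S then b else 1"
  have "(\<Prod>i\<in>S. x ! i) = (\<Prod>\<alpha><m. ?g \<alpha> (x ! \<alpha>))" for x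
    using assms by (simp add: prod.If_cases Int_absorb1)
  then have "(\<Sum>x\<in>cube m. \<Prod>i\<in>S. x ! i) = (\<Prod>\<alpha><m. ?g \<alpha> 0 + ?g \<alpha> 1)"
    unfolding sum_cube_prod[of ?g, symmetric] by simp
  also have "\<dots> = (\<Prod>\<alpha><m. if \<alpha> \<in> S then 1 else 2)" by (intro prod.cong) auto
  also have "\<dots> = 2 ^ card ({..<m} - S)" by (simp add: prod.If_cases Diff_eq)
  also have "card ({..<m} - S) = m - card S"
    using assms finite_subset[OF assms] by (simp add: card_Diff_subset)
  finally show ?thesis .
qed

text \<open>The word is the monomial in x_0 and the first r-1 of the last k variables, linear in x_0
  with a coefficient of degree r-1. It takes the value 1 at 2^(m-r) points and 0 elsewhere, and 1 is
  the lightest nonzero symbol for both weights.\<close>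

lemma code_A_light_word:
  assumes "1 \<le> r" "r \<le> k + 1" "k < m"
  obtains b :: "'h::len word vec" where "b \<in> code_A k r m" "b \<noteq> 0\<^sub>v (2 ^ m)"
    "lee_weight b = 2 ^ (m - r)"
    "sq_euclidean_weight b = 2 ^ (m - r + 2) * (sin (pi / 2 ^ LENGTH('h)))\<^sup>2"
proof -
  let ?n = "m - k"
  define S where "S = insert 0 {?n..<?n + (r - 1)}"
  have S: "S \<subseteq> {..<m}" "card S = r" using assms by (auto simp: S_def)
  define M :: "nat list \<Rightarrow> nat" where "M x = (\<Prod>i\<in>S. x ! i)" for x
  have M01: "M x = 0 \<or> M x = 1" if x: "x \<in> cube m" for x
  proof (cases "\<forall>i\<in>S. x ! i = 1")
    case False
    then obtain i where "i \<in> S" "x ! i = 0" using nth_cube[OF x] S(1) by auto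
    then show ?thesis using finite_subset[OF S(1)] by (auto simp: M_def)
  qed (simp add: M_def)
  have sumM: "(\<Sum>x\<in>cube m. M x) = 2 ^ (m - r)"
    unfolding M_def using sum_cube_monomial[OF S(1)] S(2) by simp
  define b :: "'h word vec" where "b = psi m (\<lambda>x. of_nat (M x))"
  have lee: "lee_weight b = 2 ^ (m - r)"
    unfolding b_def lee_weight_psi sumM[symmetric]
  proof (intro sum.cong refl)
    fix x assume "x \<in> cube m"
    then show "lee (of_nat (M x) :: 'h word) = M x" using M01[of x] by auto
  qed
  have "b \<in> code_A k r m"
    unfolding code_A_iff
  proof (intro exI conjI)
    let ?G = "\<lambda>(i::nat) y. if i = 0 then \<Prod>j<r-1. of_nat (y ! j) else (0 :: 'h word)"
    have "(\<lambda>y. \<Prod>j<r-1. of_nat (y ! j) :: 'h word) \<in> GBF (int (card {..<r-1})) k"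
      using assms by (intro GBF_prod GBF_coordinate) auto
    moreover have "int (card {..<r-1}) = int r - 1" using assms by simp
    ultimately have "(\<lambda>y. \<Prod>j<r-1. of_nat (y ! j) :: 'h word) \<in> GBF (int r - 1) k" by simp
    then have "?G i \<in> GBF (int r - 1) k" for i by (cases "i = 0") (simp_all add: GBF_const)
    then show "\<forall>i<?n. ?G i \<in> GBF (int r - 1) k" by blast
    show "(\<lambda>_. 0) \<in> GBF (int r) k" by (intro GBF_const) simp
    show "b = psi m (\<lambda>x. (\<Sum>i<?n. of_nat (x ! i) * ?G i (drop ?n x)) + 0)"
      unfolding b_def psi_eq_iff
    proof
      fix x :: "nat list" assume "x \<in> cube m"
      then have x: "length x = m" by (rule length_cube)
      have "M x = x ! 0 * (\<Prod>j<r-1. x ! (?n + j))"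
        using assms(3) prod.shift_bounds_nat_ivl[of "(!) x" 0 ?n "r - 1"]
        by (simp add: M_def S_def atLeast0LessThan add.commute)
      moreover have "(\<Sum>i<?n. of_nat (x ! i) * ?G i (drop ?n x)) =
          of_nat (x ! 0) * ?G 0 (drop ?n x)"
        using assms(3) by (subst sum.remove[of _ 0]) auto
      ultimately show "of_nat (M x) = (\<Sum>i<?n. of_nat (x ! i) * ?G i (drop ?n x)) + 0"
        using x by simp
    qed
  qed
  moreover have "b \<noteq> 0\<^sub>v (2 ^ m)"
  proof
    assume "b = 0\<^sub>v (2 ^ m)"
    then have "lee_weight b = 0" by (simp add: lee_weight_def)
    with lee show False by simp
  qed
  moreover have "sq_euclidean_weight b = 2 ^ (m - r + 2) * (sin (pi / 2 ^ LENGTH('h)))\<^sup>2"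
  proof -
    have "sq_euclidean_weight b = (\<Sum>x\<in>cube m. 4 * (sin (pi / 2 ^ LENGTH('h)))\<^sup>2 * real (M x))"
      unfolding b_def sq_euclidean_weight_psi 
    proof (intro sum.cong refl)
      fix x assume "x \<in> cube m"
      then show "(cmod (xi_pow (of_nat (M x) :: 'h word) - 1))\<^sup>2 =
          4 * (sin (pi / 2 ^ LENGTH('h)))\<^sup>2 * real (M x)"
        using M01[of x] xi_pow_1[where 'h = 'h] by auto
    qed
    also have "\<dots> = 4 * (sin (pi / 2 ^ LENGTH('h)))\<^sup>2 * real (\<Sum>x\<in>cube m. M x)"
      by (simp add: sum_distrib_left)
    finally show ?thesis unfolding sumM by (simp add: power_add)
  qed
  ultimately show thesis using lee that by blast
qed

lemma ERM_weights:
  fixes a :: "'h::len word vec"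
  assumes "a \<in> ERM (int r) m" "a \<noteq> 0\<^sub>v (2 ^ m)" "r \<le> m"
  shows "2 ^ (m - r) \<le> lee_weight a"
    and "2 ^ (m - r + 2) * (sin (pi / 2 ^ LENGTH('h)))\<^sup>2 \<le> sq_euclidean_weight a"
proof -
  obtain f where f: "f \<in> GBF (int r) m" "a = psi m f" using assms(1) by (auto simp: ERM_def)
  have "\<exists>x\<in>cube m. f x \<noteq> 0"
  proof (rule ccontr)
    assume "\<not> ?thesis"
    then have "psi m f = psi m (\<lambda>_. 0)" unfolding psi_eq_iff by auto
    also have "\<dots> = 0\<^sub>v (2 ^ m)" by (auto simp: psi_def)
    finally show False using assms(2) f(2) by simp
  qed
  then obtain x where "x \<in> cube m" "f x \<noteq> 0" by blast
  from lee_sum_ge[OF f(1) this] have "2 powr real (m - r) \<le> real (\<Sum>x\<in>cube m. lee (f x))"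
    using assms(3) by (simp add: of_nat_diff)
  then have *: "2 ^ (m - r) \<le> real (\<Sum>x\<in>cube m. lee (f x))" by (simp add: powr_realpow)
  then show "2 ^ (m - r) \<le> lee_weight a"
    unfolding f(2) lee_weight_psi by (metis of_nat_le_iff of_nat_numeral of_nat_power)
  have "2 ^ (m - r + 2) * (sin (pi / 2 ^ LENGTH('h)))\<^sup>2 = 4 * (sin (pi / 2 ^ LENGTH('h)))\<^sup>2 * 2 ^ (m - r)"
    by (simp add: power_add)
  also have "\<dots> \<le> 4 * (sin (pi / 2 ^ LENGTH('h)))\<^sup>2 * real (\<Sum>x\<in>cube m. lee (f x))"
    using * by (intro mult_left_mono) auto
  also have "\<dots> = (\<Sum>x\<in>cube m. 4 * (sin (pi / 2 ^ LENGTH('h)))\<^sup>2 * real (lee (f x)))"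
    by (simp add: sum_distrib_left)
  also have "\<dots> \<le> sq_euclidean_weight a"
    unfolding f(2) sq_euclidean_weight_psi by (intro sum_mono sq_euclidean_ge_lee)
  finally show "2 ^ (m - r + 2) * (sin (pi / 2 ^ LENGTH('h)))\<^sup>2 \<le> sq_euclidean_weight a" .
qed

text \<open>The explicit pair \<open>a\<close>, \<open>b\<close> shows that the set under
  \<open>Min\<close> is nonempty.\<close>

lemma min_dist_ge:
  assumes "finite C" "a \<in> C" "b \<in> C" "a \<noteq> b"
    and "\<And>a b. a \<in> C \<Longrightarrow> b \<in> C \<Longrightarrow> a \<noteq> b \<Longrightarrow> d \<le> wt (a - b)"
  shows "d \<le> min_dist wt C"
proof -
  have "{wt (a - b) | a b. a \<in> C \<and> b \<in> C \<and> a \<noteq> b} \<subseteq> (\<lambda>(a, b). wt (a - b)) ` (C \<times> C)" by auto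
  then have "finite {wt (a - b) | a b. a \<in> C \<and> b \<in> C \<and> a \<noteq> b}"
    by (rule finite_subset) (simp add: assms(1))
  then show ?thesis unfolding min_dist_def by (subst Min_ge_iff) (use assms in auto)
qed

lemma min_dist_le:
  assumes "finite C" "a \<in> C" "b \<in> C" "a \<noteq> b"
  shows "min_dist wt C \<le> wt (a - b)"
proof -
  have "{wt (a - b) | a b. a \<in> C \<and> b \<in> C \<and> a \<noteq> b} \<subseteq> (\<lambda>(a, b). wt (a - b)) ` (C \<times> C)" by auto
  then have "finite {wt (a - b) | a b. a \<in> C \<and> b \<in> C \<and> a \<noteq> b}"
    by (rule finite_subset) (simp add: assms(1))
  then show ?thesis unfolding min_dist_def by (rule Min_le) (use assms in auto)
qed

lemma ERM_add: "a \<in> ERM \<rho> m \<Longrightarrow> b \<in> ERM \<rho> m \<Longrightarrow> a + b \<in> ERM \<rho> m"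
  unfolding ERM_def by (auto simp: psi_add intro!: imageI GBF_add)

lemma ERM_diff: "a \<in> ERM \<rho> m \<Longrightarrow> b \<in> ERM \<rho> m \<Longrightarrow> a - b \<in> ERM \<rho> m"
  unfolding ERM_def by (auto simp: psi_diff intro!: imageI GBF_diff)

lemma ERM_mono: "\<rho> \<le> \<sigma> \<Longrightarrow> ERM \<rho> m \<subseteq> ERM \<sigma> m"
  unfolding ERM_def by (auto intro: GBF_mono)

theorem mainTheorem3:
  fixes k m r r' h t :: nat and s \<zeta> :: real
    and A :: "'h::len word vec set" and good_cosets :: "'h word vec set set"
  assumes "h = LENGTH('h)"
    and "m - k > 1"
    and "if h = 1 then 2 \<le> r \<and> r \<le> k + 2 else 1 \<le> r \<and> r \<le> k + 1"
    and "r' = min r (k + 1)"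
    and "t = (GREATEST u. (2::real) ^ u \<le> (fact (m - k) / 2) ^ (2 ^ min (r + h - 3) k))"
    and "\<zeta> > 0"
    and "A = code_A k r' m"
    and "s = log 2 (real (card A))"
    and "good_cosets = {K \<in> cosets_of (2 ^ m) A.
           \<exists>w \<in> K \<inter> words_R k m. word_effective_degree m w \<le> ereal (real r)}"
  shows "(\<exists>\<K>. \<K> \<subseteq> good_cosets \<and> card \<K> = 2 ^ t) \<and>
    (\<forall>\<K> C. \<K> \<subseteq> good_cosets \<and> card \<K> = 2 ^ t \<and> C = \<Union>\<K> \<longrightarrow>
      (\<forall>c\<in>C. PMEPR \<zeta> (polyphase c) \<le> 2 ^ (k + 1)) \<and>
      real (card C) = 2 powr (s + real t) \<and>
      C \<subseteq> ERM (int r) m \<and>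
      min_dist lee_weight C \<ge> 2 ^ (m - r) \<and>
      min_dist sq_euclidean_weight C \<ge> 2 ^ (m - r + 2) * (sin (pi / 2 ^ h))\<^sup>2 \<and>
      (r = r' \<longrightarrow>
        min_dist lee_weight C = 2 ^ (m - r) \<and>
        min_dist sq_euclidean_weight C = 2 ^ (m - r + 2) * (sin (pi / 2 ^ h))\<^sup>2))"
proof -
  note h = assms(1) and A = assms(7)
  have "1 \<le> h" using h by (simp add: Suc_le_eq)
  \<comment> \<open>The bound 3 <= r + h holds in both cases and keeps the natural subtraction r + h
    - 3 from truncating; likewise r <= m for m - r, using m - k > 1 when h = 1 and r = k +
    2.\<close>
  then have k: "k < m" "k \<le> m" and r: "1 \<le> r" "r \<le> m" "3 \<le> r + h"
    using assms(2,3) by (auto split: if_splits)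
  then have r': "1 \<le> r'" "r' \<le> k + 1" "r' \<le> r" using assms(4) by simp_all
  have A_carrier: "A \<subseteq> carrier_vec (2 ^ m)" and A_0: "0\<^sub>v (2 ^ m) \<in> A"
    and A_diff: "\<And>a b. a \<in> A \<Longrightarrow> b \<in> A \<Longrightarrow> a - b \<in> A"
    unfolding A by (fact code_A_carrier zero_in_code_A code_A_diff)+
  have A_fin: "finite A" by (rule finite_subset[OF A_carrier finite_carrier_vec_word])
  obtain b where b: "b \<in> A" "b \<noteq> 0\<^sub>v (2 ^ m)" "lee_weight b = 2 ^ (m - r')"
    "sq_euclidean_weight b = 2 ^ (m - r' + 2) * (sin (pi / 2 ^ h))\<^sup>2"
    using code_A_light_word[OF r'(1,2) k(1)] unfolding A h by blast
  define e where "e = min (r + h - 3) k"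
  define X :: real where "X = (fact (m - k) / 2) ^ (2 ^ e)"
  have t: "2 ^ t \<le> X"
  proof -
    \<comment> \<open>\<open>GREATEST\<close> needs a witness and a bound: u = 0 works because
      (m-k)! >= 2, and u < 2^u bounds every candidate.\<close>
    have "2 \<le> (fact (m - k) :: real)" using fact_mono[of 2 "m - k", where 'a = real] assms(2) by simp
    then have "(2::real) ^ (0::nat) \<le> X" unfolding X_def by (simp add: one_le_power)
    moreover have "u \<le> nat \<lceil>X\<rceil>" if "(2::real) ^ u \<le> X" for u
    proof -
      have "real u < 2 ^ u" by (rule of_nat_less_two_power)
      with that show ?thesis by linarith
    qed
    ultimately show ?thesis
      unfolding assms(5) e_def[symmetric] X_def[symmetric] by (rule GreatestI_nat)
  qed
  show ?thesis
  proof (intro conjI allI impI)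
    have e3: "e \<le> k" "e + 3 \<le> r + LENGTH('h)" using r(3) by (auto simp: e_def h)
    have "real (2 ^ t) \<le> (fact (m - k) / 2) ^ 2 ^ e" using t by (simp add: X_def)
    then obtain \<K> where "card \<K> = 2 ^ t" "\<K> \<subseteq> good_cosets"
      unfolding assms(9) by (rule many_good_cosets[OF k(1) e3 A])
    then show "\<exists>\<K>. \<K> \<subseteq> good_cosets \<and> card \<K> = 2 ^ t" by blast
  next
    fix \<K> C assume "\<K> \<subseteq> good_cosets \<and> card \<K> = 2 ^ t \<and> C = \<Union>\<K>"
    then have K: "\<K> \<subseteq> good_cosets" "card \<K> = 2 ^ t" "C = \<Union>\<K>" by auto
    have cosets: "\<K> \<subseteq> cosets_of (2 ^ m) A" using K(1) assms(9) by blast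
    \<comment> \<open>Each coset is re-based at its word in \<open>words_R\<close> of degree at most
      r, whatever representative it came with; the PMEPR and degree claims are then statements about
      w + c.\<close>
    have good: "\<exists>w. w \<in> words_R k m \<and> word_effective_degree m w \<le> ereal (real r) \<and>
        w \<in> carrier_vec (2 ^ m) \<and> L = {w + c | c. c \<in> A}" if LK: "L \<in> \<K>" for L
    proof -
      obtain a w where a: "a \<in> carrier_vec (2 ^ m)" "L = {a + c | c. c \<in> A}"
        and w: "w \<in> L" "w \<in> words_R k m" "word_effective_degree m w \<le> ereal (real r)"
        using LK K(1) unfolding assms(9) cosets_of_def by blast
      have "w \<in> carrier_vec (2 ^ m)" using w(1) a A_carrier by auto
      moreover have "L = {w + c | c. c \<in> A}"
        using coset_eq_of_mem[OF A_carrier A_0 A_diff a(1), of w] w(1) a(2) by simp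
      ultimately show ?thesis using w by blast
    qed
    have "\<K> \<noteq> {}" using K(2) by auto
    then obtain L where L: "L \<in> \<K>" by blast
    obtain w where w: "w \<in> carrier_vec (2 ^ m)" "L = {w + c | c. c \<in> A}" using good[OF L] by blast
    \<comment> \<open>Two words of one coset that differ by the light word \<open>b\<close>: they
      make the minimum distance meaningful and later attain it.\<close>
    have wb: "w + b \<in> C" "w + 0\<^sub>v (2 ^ m) \<in> C"
      using w(2) L K(3) b(1) A_0 by blast+
    have b_carrier: "b \<in> carrier_vec (2 ^ m)" using b(1) A_carrier by auto
    have wb_diff: "(w + b) - (w + 0\<^sub>v (2 ^ m)) = b"
      using w(1) b_carrier by (intro eq_vecI) auto
    then have wb_neq: "w + b \<noteq> w + 0\<^sub>v (2 ^ m)" using b(2) w(1) by auto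
    show ERM: "C \<subseteq> ERM (int r) m"
    proof
      fix x assume "x \<in> C"
      then obtain L where "L \<in> \<K>" "x \<in> L" using K(3) by blast
      then obtain w c where wc: "w \<in> carrier_vec (2 ^ m)" "word_effective_degree m w \<le> ereal (real r)"
        "c \<in> A" "x = w + c" using good by blast
      obtain f where f: "w = psi m f" using wc(1) by (rule carrier_vec_psi)
      have "w \<in> ERM (int r) m"
        using wc(2) unfolding f word_effective_degree_psi_le_iff psi_in_ERM_iff .
      moreover have "c \<in> ERM (int r) m"
        using wc(3) code_A_subset_ERM[OF k(2)] ERM_mono[of "int r'" "int r" m] r'(3) unfolding A by auto
      ultimately show "x \<in> ERM (int r) m" unfolding wc(4) by (rule ERM_add)
    qed
    have C_carrier: "C \<subseteq> carrier_vec (2 ^ m)" using ERM by (auto simp: ERM_def)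
    have C_fin: "finite C" by (rule finite_subset[OF C_carrier finite_carrier_vec_word])
    have diff: "x - y \<in> ERM (int r) m" "x - y \<noteq> 0\<^sub>v (2 ^ m)" if "x \<in> C" "y \<in> C" "x \<noteq> y" for x y
    proof -
      show "x - y \<in> ERM (int r) m" using that ERM by (blast intro: ERM_diff)
      have xy: "x \<in> carrier_vec (2 ^ m)" "y \<in> carrier_vec (2 ^ m)" using that C_carrier by auto
      have "x = (x - y) + y" using xy by (intro eq_vecI) auto
      then show "x - y \<noteq> 0\<^sub>v (2 ^ m)" using xy that(3) by auto
    qed
    show "real (card C) = 2 powr (s + real t)"
    proof -
      have "card C = card A * 2 ^ t"
        using card_Union_cosets[OF A_carrier A_0 A_diff A_fin cosets] K by simp
      moreover have "card A > 0" using A_fin A_0 by (auto simp: card_gt_0_iff)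
      ultimately show ?thesis unfolding assms(8) by (simp add: powr_add powr_realpow)
    qed
    show "\<forall>c\<in>C. PMEPR \<zeta> (polyphase c) \<le> 2 ^ (k + 1)"
    proof
      fix c assume c: "c \<in> C"
      obtain L where "L \<in> \<K>" "c \<in> L" using c K(3) by blast
      then obtain w a where "w \<in> words_R k m" "a \<in> A" "c = w + a" using good by blast
      then show "PMEPR \<zeta> (polyphase c) \<le> 2 ^ (k + 1)"
        using PMEPR_coset[OF k(1)] unfolding A by blast
    qed
    show lee_ge: "2 ^ (m - r) \<le> min_dist lee_weight C"
      using min_dist_ge[OF C_fin wb wb_neq] ERM_weights(1)[OF diff r(2)] by blast
    show sq_ge: "2 ^ (m - r + 2) * (sin (pi / 2 ^ h))\<^sup>2 \<le> min_dist sq_euclidean_weight C"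
      using min_dist_ge[OF C_fin wb wb_neq] ERM_weights(2)[OF diff r(2)] unfolding h by blast
    \<comment> \<open>The light word has weight 2^(m-r'), which meets the lower bound exactly when r
      = r'.\<close>
    show "min_dist lee_weight C = 2 ^ (m - r)" if "r = r'"
      using min_dist_le[OF C_fin wb wb_neq, of lee_weight] lee_ge that unfolding wb_diff b(3) by simp
    show "min_dist sq_euclidean_weight C = 2 ^ (m - r + 2) * (sin (pi / 2 ^ h))\<^sup>2" if "r = r'"
      using min_dist_le[OF C_fin wb wb_neq, of sq_euclidean_weight] sq_ge that
      unfolding wb_diff b(4) by simp
  qed
qed

end
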